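(* Let $(A_n)_{n\in\mathbb{N}}$ be a sequence of events such that $A_n\in\sigma(a_n)$ for all $n\in\mathbb{N}$. Suppose that $$V_n:=\sum_{k=1}^n \mathfrak{m}(A_k)\cdot\mathfrak{m}(A_k^c)\to\infty\quad (n\to\infty).$$ Then for $S_n:=\sum_{k=1}^n\mathbf{1}_{A_k}$ we have, for every $z\in\mathbb{R}$, $$\lim_{n\to\infty}\mathfrak{m}\left(\frac{S_n-\mathbb{E}(S_n)}{\sqrt{\mathbb{V}(S_n)}}<z\right)=\frac{1}{\sqrt{2\pi}}\int_{-\infty}^z e^{-t^2/2}\,\mathrm{d}t.$$
   Context: $I=[0,1)$ with its Borel $\sigma$-algebra. The Gauss map $G:I\to I$ is $G(\omega)=1/\omega-\lfloor 1/\omega\rfloor$ for $\omega\neq0$ and $G(0)=0$. The continued fraction digits are $a_n(\omega)=\lfloor 1/G^{n-1}(\omega)\rfloor$, $n\in\mathbb{N}=\{1,2,\dots\}$, defined for all irrational $\omega\in I$ (hence almost everywhere), so that $\omega=[a_1(\omega),a_2(\omega),\dots]$ is the regular continued fraction expansion of $\omega$. $\mathfrak{m}$ denotes the Gauss measure on $I$, i.e. the $G$-invariant probability measure with Lebesgue density $h(x)=1/((x+1)\log 2)$. $\sigma(a_n)$ is the $\sigma$-algebra generated by the single digit $a_n$; $A^c$ is the complement of $A$ and $\mathbf{1}_A$ its indicator function. $\mathbb{E}(X)$ and $\mathbb{V}(X)=\mathbb{E}((X-\mathbb{E}(X))^2)$ denote expectation and variance with respect to $\mathfrak{m}$. *)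

theory Defs
  imports "HOL-Probability.Probability"
begin

definition unit_I :: "real set" where
  "unit_I = {0..<1}"

definition gauss_map :: "real \<Rightarrow> real" where
  "gauss_map \<omega> = (if \<omega> = 0 then 0 else 1 / \<omega> - of_int \<lfloor>1 / \<omega>\<rfloor>)"

text \<open>
  Digits are indexed from \<open>n = 1\<close>; \<open>cf_digit 0\<close> is meaningless.  At the countably many rational
  points whose expansion has terminated before the \<open>n\<close>-th digit we have \<open>(gauss_map ^^ (n - 1)) \<omega> = 0\<close>,
  and the convention \<open>1 / 0 = 0\<close> makes the otherwise undefined \<open>n\<close>-th digit \<open>0\<close>, which is
  not a value taken at any irrational point.
\<close>

definition cf_digit :: "nat \<Rightarrow> real \<Rightarrow> int" where
  "cf_digit n \<omega> = \<lfloor>1 / (gauss_map ^^ (n - 1)) \<omega>\<rfloor>"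

definition digit_algebra :: "nat \<Rightarrow> real measure" where
  "digit_algebra n = vimage_algebra unit_I (cf_digit n) (count_space UNIV)"

definition gauss_measure :: "real measure" where
  "gauss_measure =
     density (restrict_space lborel unit_I) (\<lambda>x. ennreal (1 / ((x + 1) * ln 2)))"

lemma space_gauss_measure [simp]: "space gauss_measure = unit_I"
  by (simp add: gauss_measure_def space_restrict_space)

lemma sets_gauss_measure: "sets gauss_measure = sets (restrict_space borel unit_I)"
  unfolding gauss_measure_def by (simp cong: sets_restrict_space_cong)

lemma cf_digit_measurable: "cf_digit n \<in> borel \<rightarrow>\<^sub>M count_space UNIV"
proof -
  have [measurable]: "gauss_map \<in> borel_measurable borel"
    unfolding gauss_map_def [abs_def] by measurable
  have [measurable]: "(gauss_map ^^ m) \<in> borel_measurable borel" for m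
    by (induction m) (auto intro: measurable_comp simp: id_def)
  show ?thesis
    unfolding cf_digit_def [abs_def] by measurable
qed

lemma sets_digit_algebra_subset: "sets (digit_algebra n) \<subseteq> sets gauss_measure"
proof
  fix B assume "B \<in> sets (digit_algebra n)"
  then obtain D where "B = cf_digit n -` D \<inter> unit_I"
    by (auto simp: digit_algebra_def sets_vimage_algebra2)
  moreover have "cf_digit n -` D \<in> sets borel"
    using measurable_sets [OF cf_digit_measurable, of D n] by simp
  ultimately show "B \<in> sets gauss_measure"
    by (auto simp: sets_gauss_measure sets_restrict_space)
qed

lemma prob_space_gauss_measure: "prob_space gauss_measure"
proof
  let ?f = "\<lambda>x::real. 1 / ((x + 1) * ln 2)"
  have "emeasure gauss_measure (space gauss_measure)
      = (\<integral>\<^sup>+ x. ennreal (?f x) * indicator unit_I x \<partial>restrict_space lborel unit_I)"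
    unfolding gauss_measure_def
    by (subst emeasure_density)
       (auto simp: unit_I_def space_restrict_space sets_restrict_space
          intro!: measurable_restrict_space1)
  also have "\<dots> = (\<integral>\<^sup>+ x. ennreal (?f x) * indicator {0..<1} x \<partial>lborel)"
    by (subst nn_integral_restrict_space)
       (auto simp: unit_I_def indicator_def intro!: nn_integral_cong)
  also have "\<dots> = (\<integral>\<^sup>+ x. ennreal (?f x) * indicator {0..1} x \<partial>lborel)"
    by (intro nn_integral_cong_AE AE_I [where N = "{1}"]) (auto simp: indicator_def)
  also have "\<dots> = ennreal (ln (1 + 1) / ln 2 - ln (0 + 1) / ln 2)"
    by (rule nn_integral_FTC_Icc [where F = "\<lambda>x. ln (x + 1) / ln 2"])
       (auto intro!: derivative_eq_intros simp: divide_simps)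
  finally show "emeasure gauss_measure (space gauss_measure) = 1"
    by simp
qed

end

theory Submission
  imports Defs "HOL-Real_Asymp.Real_Asymp"
begin

text \<open>
  The proof is a reversed martingale argument driven by the transfer operator \<open>P\<close> of the Gauss map
  \<open>G\<close> with respect to the Gauss measure, \<open>P f x = (\<Sum>i. w i x * f (1 / (x + i + 1)))\<close> with
  \<open>w i x = (x + 1) / ((x + i + 1) * (x + i + 2))\<close>.  It is dual to composition with \<open>G\<close>:
  \<open>\<integral> f * (g \<circ> G) = \<integral> P f * g\<close>.

  Let \<open>f k\<close> be the centred indicator of the digit set behind \<open>A (k + 1)\<close>, a function of the first
  digit, and \<open>q k = \<integral> (f k)\<^sup>2\<close>, so that the centred sum is \<open>T n = (\<Sum>k<n. f k \<circ> G^k)\<close>.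
  Put \<open>H 0 = 0\<close> and \<open>H (k + 1) = P (f k + H k)\<close>.  Then \<open>T n\<close> differs from the reversed
  martingale with increments \<open>(f k + H k - H (k + 1) \<circ> G) \<circ> G^k\<close> only by the bounded term
  \<open>H n \<circ> G^n\<close>.

  \<^item> Contraction.  \<open>P\<close> turns increasing functions into decreasing ones (the digit distribution given
    \<open>x\<close> is stochastically increasing in \<open>x\<close>), and \<open>P\<close> maps \<open>\<phi> x = x + x / (1 + x)\<close> to
    \<open>1 / (1 + x)\<close>.  Hence \<open>P\<close> halves the Lipschitz constant with respect to the scale \<open>\<phi>\<close>
    (\<open>phi_lip_transfer_op\<close>), while \<open>P\<close> of an indicator of a digit set has constant at most
    \<open>1 / 8\<close> (\<open>phi_lip_digit_event\<close>) and \<open>P (f k)\<close> has constant at most \<open>6 * q k\<close>.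

  \<^item> Variance.  By the first bound every \<open>H n\<close> oscillates by at most \<open>3 / 8\<close>.  Together with
    \<open>\<integral> \<bar>f n\<bar> = 2 * q n\<close> this makes the covariance of \<open>T n\<close> with the next summand at most
    \<open>(3 / 8) * q n\<close> in absolute value, so each step adds at least \<open>q n / 4\<close> to the variance
    (\<open>var_lower\<close>).

  \<^item> Conditional variances.  The second bound gives a pointwise upper bound, of the order of the
    variance, for the sum of the conditional variances of the increments
    (\<open>sum_cond_var_bound\<close>); and since these are uniformly Lipschitz functions along the orbit,
    the covariance argument above also shows that their sum deviates from the variance of \<open>T n\<close> by
    only the order of its square root in mean (\<open>integral_abs_Q_diff\<close>).

  \<^item> Characteristic function.  The product of the factors
    \<open>exp (\<i> * \<theta> * increment + \<theta>\<^sup>2 / 2 * conditional variance)\<close> is bounded and its integral is close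
    to \<open>1\<close>, by a second order Taylor expansion under \<open>P\<close> in each factor
    (\<open>integral_steps_bound\<close>).  Replacing the sum of conditional variances by the variance yields
    \<open>char_bound\<close>, and Levy's continuity theorem concludes.
\<close>

section \<open>The transfer operator of the Gauss map\<close>

text \<open>
  The irrational points of the unit interval: a set of full measure that is mapped into itself by the
  Gauss map and by all its inverse branches.  Orbits and preimages are only considered for points
  of this set.
\<close>

definition irr_I :: "real set" where
  "irr_I = {x. 0 < x \<and> x < 1 \<and> x \<notin> \<rat>}"

text \<open>
  The inverse branch belonging to the digit \<open>i + 1\<close>, and its weight: the conditional probability,
  under the Gauss measure, that the first digit is \<open>i + 1\<close> given that the image point is \<open>x\<close>.
\<close>

definition inv_branch :: "nat \<Rightarrow> real \<Rightarrow> real" where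
  "inv_branch i x = 1 / (x + real i + 1)"

definition branch_weight :: "nat \<Rightarrow> real \<Rightarrow> real" where
  "branch_weight i x = (x + 1) / ((x + real i + 1) * (x + real i + 2))"

text \<open>
  The transfer operator with respect to the Gauss measure.  It is also used for complex functions,
  which is why the codomain is a general Banach space.
\<close>

definition transfer_op :: "(real \<Rightarrow> 'a) \<Rightarrow> real \<Rightarrow> 'a::{banach, second_countable_topology}" where
  "transfer_op f x = (\<Sum>i. branch_weight i x *\<^sub>R f (inv_branch i x))"

text \<open>
  Borel functions that are bounded on \<^const>\<open>irr_I\<close>.  The transfer operator is only studied on
  these; outside \<^const>\<open>irr_I\<close> their values are unrestricted.
\<close>

definition bdd_meas :: "(real \<Rightarrow> 'a::{banach, second_countable_topology}) \<Rightarrow> bool" where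
  "bdd_meas f \<longleftrightarrow> f \<in> borel_measurable borel \<and> (\<exists>B. \<forall>x\<in>irr_I. norm (f x) \<le> B)"

interpretation gauss: prob_space gauss_measure
  by (rule prob_space_gauss_measure)

lemma irr_I_pos: "x \<in> irr_I \<Longrightarrow> 0 < x"
  by (auto simp: irr_I_def)

lemma inv_branch_irr_I: "x \<in> irr_I \<Longrightarrow> inv_branch i x \<in> irr_I"
proof -
  assume x: "x \<in> irr_I"
  have "inv_branch i x \<notin> \<rat>"
  proof
    assume "inv_branch i x \<in> \<rat>"
    then have "1 / inv_branch i x - of_nat i - 1 \<in> \<rat>"
      by (intro Rats_diff Rats_divide) auto
    also have "1 / inv_branch i x - of_nat i - 1 = x"
      using x by (simp add: inv_branch_def)
    finally show False using x by (simp add: irr_I_def)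
  qed
  then show ?thesis using x by (auto simp: irr_I_def inv_branch_def)
qed

lemma gauss_map_irr_I: "x \<in> irr_I \<Longrightarrow> gauss_map x \<in> irr_I"
proof -
  assume x: "x \<in> irr_I"
  have nr: "gauss_map x \<notin> \<rat>"
  proof
    assume *: "gauss_map x \<in> \<rat>"
    have "1 / (gauss_map x + of_int \<lfloor>1 / x\<rfloor>) \<in> \<rat>"
      by (intro Rats_divide Rats_add *) auto
    also have "1 / (gauss_map x + of_int \<lfloor>1 / x\<rfloor>) = x"
      using x by (simp add: gauss_map_def irr_I_def)
    finally show False using x by (simp add: irr_I_def)
  qed
  moreover have "gauss_map x \<ge> 0" "gauss_map x < 1"
    by (auto simp: gauss_map_def) linarith
  moreover have "gauss_map x \<noteq> 0" using nr by auto
  ultimately show ?thesis by (auto simp: irr_I_def)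
qed

lemma gauss_map_funpow_irr_I: "x \<in> irr_I \<Longrightarrow> (gauss_map ^^ n) x \<in> irr_I"
  by (induction n) (auto intro: gauss_map_irr_I)

lemma floor_inverse_inv_branch: "x \<in> irr_I \<Longrightarrow> \<lfloor>1 / inv_branch i x\<rfloor> = int i + 1"
  by (auto simp: inv_branch_def irr_I_def floor_eq_iff)

lemma gauss_map_inv_branch: "x \<in> irr_I \<Longrightarrow> gauss_map (inv_branch i x) = x"
  using inv_branch_irr_I[of x i]
  by (auto simp: gauss_map_def floor_inverse_inv_branch irr_I_def) (simp add: inv_branch_def)

lemma measurable_gauss_map [measurable]: "gauss_map \<in> borel_measurable borel"
  unfolding gauss_map_def [abs_def] by measurable

lemma measurable_gauss_map_funpow [measurable]: "(gauss_map ^^ m) \<in> borel_measurable borel"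
  by (induction m) (auto intro: measurable_comp simp: id_def)

lemma measurable_gauss_measureI [measurable_dest]:
  "f \<in> borel_measurable borel \<Longrightarrow> f \<in> borel_measurable gauss_measure"
  using measurable_restrict_space1[of f borel borel unit_I]
  by (subst measurable_cong_sets[OF sets_gauss_measure refl])

lemma measurable_inv_branch [measurable]: "inv_branch i \<in> borel_measurable borel"
  unfolding inv_branch_def [abs_def] by measurable

lemma measurable_branch_weight [measurable]: "branch_weight i \<in> borel_measurable borel"
  unfolding branch_weight_def [abs_def] by measurable

lemma measurable_transfer_op [measurable]:
  "f \<in> borel_measurable borel \<Longrightarrow> transfer_op f \<in> borel_measurable borel"
  unfolding transfer_op_def [abs_def]
  by (intro borel_measurable_suminf borel_measurable_scaleR measurable_branch_weight
    measurable_compose [OF measurable_inv_branch])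

lemma nn_integral_gauss_measure:
  assumes [measurable]: "f \<in> borel_measurable borel"
  shows "(\<integral>\<^sup>+x. f x \<partial>gauss_measure)
    = (\<integral>\<^sup>+x. f x * ennreal (1 / ((x + 1) * ln 2)) * indicator {0..1} x \<partial>lborel)"
proof -
  have "(\<integral>\<^sup>+x. f x \<partial>gauss_measure)
    = (\<integral>\<^sup>+x. ennreal (1 / ((x + 1) * ln 2)) * f x \<partial>restrict_space lborel unit_I)"
    unfolding gauss_measure_def
    by (subst nn_integral_density) (auto intro!: measurable_restrict_space1)
  also have "\<dots> = (\<integral>\<^sup>+x. ennreal (1 / ((x + 1) * ln 2)) * f x * indicator unit_I x \<partial>lborel)"
    by (subst nn_integral_restrict_space) (auto simp: unit_I_def)
  also have "\<dots> = (\<integral>\<^sup>+x. f x * ennreal (1 / ((x + 1) * ln 2)) * indicator {0..1} x \<partial>lborel)"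
    by (intro nn_integral_cong_AE AE_I [where N = "{1}"])
       (auto simp: unit_I_def indicator_def mult.commute)
  finally show ?thesis .
qed

lemma AE_irr_I: "AE x in gauss_measure. x \<in> irr_I"
proof -
  have meas: "\<rat> \<in> sets (borel :: real measure)"
    by (rule sets.countable) (auto intro: countable_rat)
  have "emeasure gauss_measure (\<rat> \<inter> unit_I) = (\<integral>\<^sup>+x. indicator \<rat> x \<partial>gauss_measure)"
    using meas by (subst nn_integral_indicator[symmetric])
      (auto simp: sets_gauss_measure sets_restrict_space intro!: nn_integral_cong split: split_indicator)
  also have "\<dots> = (\<integral>\<^sup>+x. indicator \<rat> x * ennreal (1 / ((x + 1) * ln 2)) * indicator {0..1} x \<partial>lborel)"
    using meas by (intro nn_integral_gauss_measure) auto
  also have "\<dots> = (\<integral>\<^sup>+x. 0 \<partial>(lborel :: real measure))"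
    using meas by (intro nn_integral_cong_AE AE_I [where N = "\<rat>"])
      (auto simp: indicator_def emeasure_lborel_countable countable_rat)
  finally have "\<rat> \<inter> unit_I \<in> null_sets gauss_measure"
    using meas by (auto simp: null_sets_def sets_gauss_measure sets_restrict_space)
  then show ?thesis
    by (rule AE_I') (auto simp: irr_I_def unit_I_def less_le)
qed

text \<open>
  Substitution along one inverse branch.  The branch is decreasing, so the integral is first
  reflected at the origin.
\<close>

lemma nn_integral_branch:
  fixes f :: "real \<Rightarrow> ennreal"
  assumes [measurable]: "f \<in> borel_measurable borel"
  shows "(\<integral>\<^sup>+x. f x * indicator {inv_branch i 1..inv_branch i 0} x \<partial>lborel)
    = (\<integral>\<^sup>+x. f (inv_branch i x) * ennreal ((inv_branch i x)\<^sup>2) * indicator {0..1} x \<partial>lborel)"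
proof -
  have "(\<integral>\<^sup>+x. f x * indicator {inv_branch i 1..inv_branch i 0} x \<partial>lborel)
      = (\<integral>\<^sup>+x. f (-x) * indicator {inv_branch i 1..inv_branch i 0} (-x) \<partial>lborel)"
    by (subst nn_integral_real_affine[where c = "-1" and t = 0]) auto
  also have "\<dots> = (\<integral>\<^sup>+x. f (-x) * indicator {- inv_branch i 0..- inv_branch i 1} x \<partial>lborel)"
    by (intro nn_integral_cong) (auto simp: indicator_def)
  also have "\<dots> = (\<integral>\<^sup>+x. f (- (- inv_branch i x)) * ennreal ((inv_branch i x)\<^sup>2) * indicator {0..1} x \<partial>lborel)"
  proof (rule nn_integral_substitution_aux)
    show "((\<lambda>x. - inv_branch i x) has_real_derivative (inv_branch i x)\<^sup>2) (at x)"
      if "x \<in> {0..1}" for x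
      unfolding inv_branch_def using that
      by (auto intro!: derivative_eq_intros simp: power2_eq_square divide_simps)
    show "continuous_on {0..1} (\<lambda>x. (inv_branch i x)\<^sup>2)"
      unfolding inv_branch_def by (intro continuous_intros) auto
  qed auto
  finally show ?thesis by simp
qed

section \<open>Invariance of the Gauss measure\<close>

lemma branch_weight_pos: "x \<in> irr_I \<Longrightarrow> 0 < branch_weight i x"
  by (auto simp: branch_weight_def irr_I_def)

text \<open>
  The weights are the successive decrements of \<open>(x + 1) / (x + i + 1)\<close>, the probability that the digit
  exceeds \<open>i\<close> under the weights at \<open>x\<close>.
\<close>

lemma branch_weight_telescope:
  assumes "0 \<le> x"
  shows "branch_weight i x = (x + 1) / (x + real i + 1) - (x + 1) / (x + real i + 2)"
proof -
  define a where "a = x + real i + 1"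
  have "a > 0" using assms by (simp add: a_def)
  then have "b / (a * (a + 1)) = b / a - b / (a + 1)" for b :: real
    by (simp add: field_simps)
  then show ?thesis by (simp add: branch_weight_def a_def add_ac)
qed

lemma sum_branch_weight:
  assumes "0 \<le> x"
  shows "(\<Sum>i<n. branch_weight i x) = 1 - (x + 1) / (x + real n + 1)"
proof (induction n)
  case (Suc n)
  have "branch_weight n x = (x + 1) / (x + real n + 1) - (x + 1) / (x + real n + 1 + 1)"
    using branch_weight_telescope [OF assms, of n] by (simp add: add_ac)
  with Suc show ?case by (simp add: add_ac)
qed (use assms in auto)

lemma tail_tendsto_0: "(\<lambda>n. (x + 1) / (x + real n + 1)) \<longlonglongrightarrow> 0"
  by real_asymp

lemma branch_weight_sums:
  assumes "0 \<le> x"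
  shows "(\<lambda>i. branch_weight i x) sums 1"
proof -
  have "(\<lambda>n. 1 - (x + 1) / (x + real n + 1)) \<longlonglongrightarrow> 1 - 0"
    by (intro tendsto_intros tail_tendsto_0)
  then show ?thesis
    using assms by (simp add: sums_def sum_branch_weight)
qed

text \<open>
  The images of the branches tile the unit interval up to their endpoints.
\<close>

lemma suminf_branch_indicator:
  assumes y: "y \<in> {0..1}" "y \<noteq> 0" "y \<notin> range (\<lambda>i. 1 / (real i + 1))"
  shows "(\<Sum>i. c * indicator {inv_branch i 1..inv_branch i 0} y) = (c :: ennreal)"
proof -
  define k where "k = nat (\<lfloor>1 / y\<rfloor> - 1)"
  have "\<lfloor>1 / y\<rfloor> \<ge> 1" using y by auto
  then have k: "\<lfloor>1 / y\<rfloor> = int k + 1" by (simp add: k_def)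
  have "real k + 1 \<le> 1 / y" "1 / y < real k + 2"
    using k by (simp_all add: floor_eq_iff)
  then have "y \<le> 1 / (real k + 1)" "1 / (real k + 2) < y"
    using y by (simp_all add: field_simps)
  then have yk: "y \<in> {inv_branch k 1..inv_branch k 0}"
    by (simp add: inv_branch_def add.commute)
  have only: "i = k" if "y \<in> {inv_branch i 1..inv_branch i 0}" for i
  proof -
    have "y \<noteq> 1 / (real i + 1)" "y \<noteq> 1 / (real (Suc i) + 1)" using y(3) by blast+
    with that have "1 / (real i + 2) < y" "y < 1 / (real i + 1)"
      by (auto simp: inv_branch_def less_le add.commute)
    then have "real i + 1 < 1 / y" "1 / y < real i + 2"
      using y by (simp_all add: field_simps)
    then have "\<lfloor>1 / y\<rfloor> = int i + 1" by (simp add: floor_eq_iff)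
    with k show ?thesis by simp
  qed
  have "(\<Sum>i. c * indicator {inv_branch i 1..inv_branch i 0} y)
    = (\<Sum>i\<in>{k}. c * indicator {inv_branch i 1..inv_branch i 0} y)"
    by (rule suminf_finite) (use only in \<open>auto simp: indicator_def\<close>)
  also have "\<dots> = c * indicator {inv_branch k 1..inv_branch k 0} y"
    by (simp del: sum_mult_indicator)
  also have "\<dots> = c"
    using yk by simp
  finally show ?thesis .
qed

lemma nn_integral_transfer:
  fixes f :: "real \<Rightarrow> ennreal"
  assumes [measurable]: "f \<in> borel_measurable borel"
  shows "(\<integral>\<^sup>+x. (\<Sum>i. ennreal (branch_weight i x) * f (inv_branch i x)) \<partial>gauss_measure)
    = (\<integral>\<^sup>+x. f x \<partial>gauss_measure)"
proof -
  define g where "g y = f y * ennreal (1 / ((y + 1) * ln 2))" for y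
  have [measurable]: "g \<in> borel_measurable borel"
    unfolding g_def [abs_def] by measurable
  have [measurable]: "(\<lambda>x. f (inv_branch i x)) \<in> borel_measurable borel" for i
    by (rule measurable_compose [OF measurable_inv_branch]) fact
  have eq: "(\<integral>\<^sup>+x. ennreal (branch_weight i x) * f (inv_branch i x) \<partial>gauss_measure)
     = (\<integral>\<^sup>+x. g x * indicator {inv_branch i 1..inv_branch i 0} x \<partial>lborel)" for i
  proof -
    have "(\<integral>\<^sup>+x. ennreal (branch_weight i x) * f (inv_branch i x) \<partial>gauss_measure)
      = (\<integral>\<^sup>+x. ennreal (branch_weight i x) * f (inv_branch i x) * ennreal (1 / ((x + 1) * ln 2))
          * indicator {0..1} x \<partial>lborel)"
      by (rule nn_integral_gauss_measure) measurable
    also have "\<dots> = (\<integral>\<^sup>+x. g (inv_branch i x) * ennreal ((inv_branch i x)\<^sup>2) * indicator {0..1} x \<partial>lborel)"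
    proof (intro nn_integral_cong)
      fix x :: real
      show "ennreal (branch_weight i x) * f (inv_branch i x) * ennreal (1 / ((x + 1) * ln 2)) * indicator {0..1} x
        = g (inv_branch i x) * ennreal ((inv_branch i x)\<^sup>2) * indicator {0..1} x"
      proof (cases "x \<in> {0..1}")
        case True
        have *: "branch_weight i x * (1 / ((x + 1) * ln 2))
            = 1 / ((inv_branch i x + 1) * ln 2) * (inv_branch i x)\<^sup>2"
        proof -
          define a where "a = x + real i + 1"
          have a: "a > 0" and x: "x + 1 > 0" using True by (auto simp: a_def)
          have "b / (a * (a + 1)) * (1 / (b * c)) = 1 / ((1 / a + 1) * c) * (1 / a)\<^sup>2"
            if "b > 0" for b c :: real
            using a that by (simp add: power2_eq_square divide_simps)
          from this [OF x] have "(x + 1) / (a * (a + 1)) * (1 / ((x + 1) * ln 2))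
              = 1 / ((1 / a + 1) * ln 2) * (1 / a)\<^sup>2" .
          moreover have a1: "x + real i + 2 = a + 1" by (simp add: a_def)
          ultimately show ?thesis
            unfolding branch_weight_def inv_branch_def a1 a_def [symmetric] by blast
        qed
        have nn: "0 \<le> branch_weight i x" "0 \<le> 1 / ((x + 1) * ln 2)" "0 \<le> 1 / ((inv_branch i x + 1) * ln 2)"
          using True by (auto simp: branch_weight_def inv_branch_def)
        have "ennreal (branch_weight i x) * ennreal (1 / ((x + 1) * ln 2))
          = ennreal (1 / ((inv_branch i x + 1) * ln 2)) * ennreal ((inv_branch i x)\<^sup>2)"
          unfolding ennreal_mult [OF nn(1,2), symmetric] ennreal_mult [OF nn(3) zero_le_power2, symmetric] *
          by (rule refl)
        then show ?thesis
          by (simp add: g_def mult_ac) (metis mult.assoc mult.commute)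
      qed simp
    qed
    also have "\<dots> = (\<integral>\<^sup>+x. g x * indicator {inv_branch i 1..inv_branch i 0} x \<partial>lborel)"
      by (rule nn_integral_branch [symmetric]) measurable
    finally show ?thesis .
  qed
  let ?N = "insert 0 (range (\<lambda>i. 1 / (real i + 1)))"
  have N: "?N \<in> null_sets lborel"
    by (intro countable_imp_null_set_lborel) auto
  have "(\<integral>\<^sup>+x. (\<Sum>i. ennreal (branch_weight i x) * f (inv_branch i x)) \<partial>gauss_measure)
     = (\<Sum>i. \<integral>\<^sup>+x. ennreal (branch_weight i x) * f (inv_branch i x) \<partial>gauss_measure)"
    by (intro nn_integral_suminf measurable_gauss_measureI) measurable
  also have "\<dots> = (\<integral>\<^sup>+x. (\<Sum>i. g x * indicator {inv_branch i 1..inv_branch i 0} x) \<partial>lborel)"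
    unfolding eq by (intro nn_integral_suminf [symmetric]) measurable
  also have "\<dots> = (\<integral>\<^sup>+x. g x * indicator {0..1} x \<partial>lborel)"
  proof (rule nn_integral_cong_AE)
    show "AE x in lborel. (\<Sum>i. g x * indicator {inv_branch i 1..inv_branch i 0} x)
        = g x * indicator {0..1} x"
    proof (rule AE_I' [OF N], rule subsetI)
      fix x assume "x \<in> {x \<in> space lborel. (\<Sum>i. g x * indicator {inv_branch i 1..inv_branch i 0} x)
        \<noteq> g x * indicator {0..1} x}"
      then have ne: "(\<Sum>i. g x * indicator {inv_branch i 1..inv_branch i 0} x) \<noteq> g x * indicator {0..1} x"
        by simp
      show "x \<in> ?N"
      proof (rule ccontr)
        assume x: "x \<notin> ?N"
        show False
        proof (cases "x \<in> {0..1}")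
          case True
          with suminf_branch_indicator [of x "g x"] x ne show False by auto
        next
          case False
          have sub: "0 \<le> inv_branch i 1" "inv_branch i 0 \<le> 1" for i
            by (auto simp: inv_branch_def)
          have "(\<Sum>i. g x * indicator {inv_branch i 1..inv_branch i 0} x) = (\<Sum>i. 0)"
            using False order_trans [OF sub(1)] order_trans [OF _ sub(2)]
            by (intro suminf_cong) (auto simp: indicator_def)
          with ne False show False by simp
        qed
      qed
    qed
  qed
  also have "\<dots> = (\<integral>\<^sup>+x. f x \<partial>gauss_measure)"
    by (simp add: nn_integral_gauss_measure g_def)
  finally show ?thesis .
qed

section \<open>The transfer operator on bounded measurable functions\<close>

lemma bdd_measD: "bdd_meas f \<Longrightarrow> f \<in> borel_measurable borel"
  by (simp add: bdd_meas_def)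

lemma bdd_measE:
  assumes "bdd_meas f"
  obtains B where "B > 0" "\<And>x. x \<in> irr_I \<Longrightarrow> norm (f x) \<le> B"
proof -
  from assms obtain B where "\<forall>x\<in>irr_I. norm (f x) \<le> B" by (auto simp: bdd_meas_def)
  then show ?thesis
    using that[of "max B 1"] by (auto simp: le_max_iff_disj)
qed

lemma bdd_measI:
  "f \<in> borel_measurable borel \<Longrightarrow> (\<And>x. x \<in> irr_I \<Longrightarrow> norm (f x) \<le> B) \<Longrightarrow> bdd_meas f"
  by (auto simp: bdd_meas_def)

lemma summable_transfer_op:
  assumes "bdd_meas f" "x \<in> irr_I"
  shows "summable (\<lambda>i. norm (branch_weight i x *\<^sub>R f (inv_branch i x)))"
    and "summable (\<lambda>i. branch_weight i x *\<^sub>R f (inv_branch i x))"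
proof -
  obtain B where B: "B > 0" "\<And>x. x \<in> irr_I \<Longrightarrow> norm (f x) \<le> B"
    using bdd_measE[OF assms(1)] by metis
  have sB: "summable (\<lambda>i. branch_weight i x * B)"
    using branch_weight_sums[of x] irr_I_pos[OF assms(2)]
    by (intro summable_mult2) (auto simp: sums_iff)
  have le: "norm (norm (branch_weight i x *\<^sub>R f (inv_branch i x))) \<le> branch_weight i x * B" for i
    using mult_left_mono [OF B(2) [OF inv_branch_irr_I [OF assms(2), of i]], of "branch_weight i x"]
      branch_weight_pos [OF assms(2), of i] by simp
  show *: "summable (\<lambda>i. norm (branch_weight i x *\<^sub>R f (inv_branch i x)))"
    by (rule summable_comparison_test' [OF sB le])
  then show "summable (\<lambda>i. branch_weight i x *\<^sub>R f (inv_branch i x))"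
    by (rule summable_norm_cancel)
qed

lemma transfer_op_add:
  "bdd_meas f \<Longrightarrow> bdd_meas g \<Longrightarrow> x \<in> irr_I \<Longrightarrow>
    transfer_op (\<lambda>y. f y + g y) x = transfer_op f x + transfer_op g x"
  unfolding transfer_op_def scaleR_add_right
  by (intro suminf_add [symmetric] summable_transfer_op)

lemma transfer_op_diff:
  "bdd_meas f \<Longrightarrow> bdd_meas g \<Longrightarrow> x \<in> irr_I \<Longrightarrow>
    transfer_op (\<lambda>y. f y - g y) x = transfer_op f x - transfer_op g x"
  unfolding transfer_op_def scaleR_diff_right
  by (intro suminf_diff [symmetric] summable_transfer_op)

lemma transfer_op_const: "x \<in> irr_I \<Longrightarrow> transfer_op (\<lambda>_. c) x = c"
  using branch_weight_sums[of x, THEN sums_scaleR_left, of c] irr_I_pos[of x]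
  by (simp add: transfer_op_def sums_iff)

lemma transfer_op_mult_left:
  fixes c :: "'a :: {real_normed_algebra, banach, second_countable_topology}"
  assumes "bdd_meas f" "x \<in> irr_I"
  shows "transfer_op (\<lambda>y. c * f y) x = c * transfer_op f x"
  unfolding transfer_op_def mult_scaleR_right [symmetric]
  by (intro suminf_mult summable_transfer_op assms)

text \<open>
  A factor that only depends on the image point can be pulled out of the transfer operator.
  Combined with the preservation of integrals this is the duality used throughout
  (\<open>integral_mult_gauss_map_real\<close>, \<open>integral_mult_gauss_map_complex\<close>).
\<close>

lemma transfer_op_mult_gauss_map:
  fixes f :: "real \<Rightarrow> 'a :: {real_normed_algebra, banach, second_countable_topology}"
  assumes "bdd_meas f" "x \<in> irr_I"
  shows "transfer_op (\<lambda>y. f y * g (gauss_map y)) x = transfer_op f x * g x"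
  using assms(2) unfolding transfer_op_def
  by (simp add: gauss_map_inv_branch flip: mult_scaleR_left)
    (intro suminf_mult2 [symmetric] summable_transfer_op assms)

lemma transfer_op_mono:
  fixes f g :: "real \<Rightarrow> real"
  assumes "bdd_meas f" "bdd_meas g" "x \<in> irr_I" "\<And>y. y \<in> irr_I \<Longrightarrow> f y \<le> g y"
  shows "transfer_op f x \<le> transfer_op g x"
  unfolding transfer_op_def
  using assms branch_weight_pos[OF assms(3)]
  by (intro suminf_le summable_transfer_op scaleR_left_mono)
    (auto intro: inv_branch_irr_I less_imp_le)

lemma transfer_op_norm_le:
  assumes "bdd_meas f" "x \<in> irr_I"
  shows "norm (transfer_op f x) \<le> transfer_op (\<lambda>y. norm (f y)) x"
proof -
  have "norm (transfer_op f x) \<le> (\<Sum>i. norm (branch_weight i x *\<^sub>R f (inv_branch i x)))"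
    unfolding transfer_op_def by (intro summable_norm summable_transfer_op assms)
  also have "\<dots> = transfer_op (\<lambda>y. norm (f y)) x"
    using branch_weight_pos[OF assms(2)] by (simp add: transfer_op_def abs_of_pos)
  finally show ?thesis .
qed

lemma bdd_meas_const [simp]: "bdd_meas (\<lambda>_. c)"
  by (rule bdd_measI[of _ "norm c"]) auto

lemma transfer_op_comp_gauss_map:
  fixes g :: "real \<Rightarrow> real"
  assumes "x \<in> irr_I" shows "transfer_op (\<lambda>y. g (gauss_map y)) x = g x"
  using transfer_op_mult_gauss_map [of "\<lambda>_. 1" x g] assms by (simp add: transfer_op_const)

lemma bdd_meas_add:
  assumes "bdd_meas f" "bdd_meas g" shows "bdd_meas (\<lambda>x. f x + g x)"
proof -
  obtain B C where "\<And>x. x \<in> irr_I \<Longrightarrow> norm (f x) \<le> B" "\<And>x. x \<in> irr_I \<Longrightarrow> norm (g x) \<le> C"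
    using assms by (auto elim!: bdd_measE)
  then show ?thesis using assms[THEN bdd_measD]
    by (intro bdd_measI[of _ "B + C"]) (auto intro: norm_triangle_mono)
qed

lemma bdd_meas_mult:
  fixes f :: "real \<Rightarrow> 'a :: {real_normed_algebra, banach, second_countable_topology}"
  assumes "bdd_meas f" "bdd_meas g" shows "bdd_meas (\<lambda>x. f x * g x)"
proof -
  obtain B C where "B > 0" "\<And>x. x \<in> irr_I \<Longrightarrow> norm (f x) \<le> B" "\<And>x. x \<in> irr_I \<Longrightarrow> norm (g x) \<le> C"
    using assms by (auto elim!: bdd_measE)
  then show ?thesis using assms[THEN bdd_measD]
    by (intro bdd_measI[of _ "B * C"])
      (auto intro!: order_trans [OF norm_mult_ineq] mult_mono)
qed

lemma bdd_meas_diff: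
  assumes "bdd_meas f" "bdd_meas g" shows "bdd_meas (\<lambda>x. f x - g x)"
proof -
  obtain B C where "\<And>x. x \<in> irr_I \<Longrightarrow> norm (f x) \<le> B" "\<And>x. x \<in> irr_I \<Longrightarrow> norm (g x) \<le> C"
    using assms by (auto elim!: bdd_measE)
  then show ?thesis using assms[THEN bdd_measD]
    by (intro bdd_measI[of _ "B + C"]) (auto intro!: order_trans [OF norm_triangle_ineq4] add_mono)
qed

lemma bdd_meas_power2: "bdd_meas f \<Longrightarrow> bdd_meas (\<lambda>x. (f x :: real)\<^sup>2)"
  unfolding power2_eq_square by (intro bdd_meas_mult)

lemma bdd_meas_norm: "bdd_meas f \<Longrightarrow> bdd_meas (\<lambda>x. norm (f x))"
  by (frule bdd_measD, erule bdd_measE, rule bdd_measI) auto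

lemma bdd_meas_abs: "bdd_meas f \<Longrightarrow> bdd_meas (\<lambda>x. \<bar>f x :: real\<bar>)"
  using bdd_meas_norm[of f] by simp

lemma bdd_meas_sum: "(\<And>i. i \<in> I \<Longrightarrow> bdd_meas (f i)) \<Longrightarrow> bdd_meas (\<lambda>x. \<Sum>i\<in>I. f i x)"
  by (induction I rule: infinite_finite_induct) (auto intro: bdd_meas_add)

lemma bdd_meas_gauss_map_funpow: "bdd_meas f \<Longrightarrow> bdd_meas (\<lambda>x. f ((gauss_map ^^ n) x))"
  by (frule bdd_measD, erule bdd_measE, rule bdd_measI)
    (auto intro: measurable_compose [OF measurable_gauss_map_funpow] gauss_map_funpow_irr_I)

lemma bdd_meas_gauss_map: "bdd_meas f \<Longrightarrow> bdd_meas (\<lambda>x. f (gauss_map x))"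
  using bdd_meas_gauss_map_funpow[of f 1] by simp

lemma bdd_meas_of_real: "bdd_meas f \<Longrightarrow> bdd_meas (\<lambda>x. complex_of_real (f x))"
  by (frule bdd_measD, erule bdd_measE, rule bdd_measI) auto

lemma bdd_meas_transfer_op:
  assumes "bdd_meas f" shows "bdd_meas (transfer_op f)"
proof -
  obtain B where B: "\<And>x. x \<in> irr_I \<Longrightarrow> norm (f x) \<le> B"
    using bdd_measE[OF assms] by metis
  show ?thesis
  proof (rule bdd_measI)
    fix x assume x: "x \<in> irr_I"
    have "norm (transfer_op f x) \<le> transfer_op (\<lambda>y. norm (f y)) x"
      by (rule transfer_op_norm_le) fact+
    also have "\<dots> \<le> transfer_op (\<lambda>_. B) x"
      by (intro transfer_op_mono bdd_meas_norm assms x) (auto simp: B)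
    finally show "norm (transfer_op f x) \<le> B" using x by (simp add: transfer_op_const)
  qed (use assms in \<open>auto dest: bdd_measD\<close>)
qed

lemmas bdd_meas_intros = bdd_meas_const bdd_meas_add bdd_meas_diff bdd_meas_mult bdd_meas_power2
  bdd_meas_sum bdd_meas_gauss_map bdd_meas_gauss_map_funpow bdd_meas_transfer_op bdd_meas_abs
  bdd_meas_of_real

lemma transfer_op_Re: "bdd_meas f \<Longrightarrow> x \<in> irr_I \<Longrightarrow> Re (transfer_op f x) = transfer_op (\<lambda>y. Re (f y)) x"
  and transfer_op_Im: "bdd_meas f \<Longrightarrow> x \<in> irr_I \<Longrightarrow> Im (transfer_op f x) = transfer_op (\<lambda>y. Im (f y)) x"
  unfolding transfer_op_def
  by (simp_all add: bounded_linear.suminf [OF bounded_linear_Re summable_transfer_op(2)]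
    bounded_linear.suminf [OF bounded_linear_Im summable_transfer_op(2)])

lemma transfer_op_of_real:
  "bdd_meas f \<Longrightarrow> x \<in> irr_I \<Longrightarrow> transfer_op (\<lambda>y. complex_of_real (f y)) x = of_real (transfer_op f x)"
  by (rule complex_eqI) (simp_all add: transfer_op_Re transfer_op_Im bdd_meas_of_real transfer_op_const)

lemma integrable_bdd_meas: "bdd_meas f \<Longrightarrow> integrable gauss_measure f"
  by (frule bdd_measD, erule bdd_measE, rule gauss.integrable_const_bound)
    (auto intro: measurable_gauss_measureI AE_mp [OF AE_irr_I])

lemma integral_irr_I_cong:
  fixes f :: "real \<Rightarrow> 'a::{banach, second_countable_topology}"
  assumes "bdd_meas f" "g \<in> borel_measurable borel" "\<And>x. x \<in> irr_I \<Longrightarrow> f x = g x"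
  shows "(\<integral>x. f x \<partial>gauss_measure) = (\<integral>x. g x \<partial>gauss_measure)"
  using assms
  by (intro integral_cong_AE) (auto intro: bdd_measD measurable_gauss_measureI AE_mp [OF AE_irr_I])

lemma integral_irr_I_mono:
  fixes f :: "real \<Rightarrow> real"
  assumes "bdd_meas f" "bdd_meas g" "\<And>x. x \<in> irr_I \<Longrightarrow> f x \<le> g x"
  shows "(\<integral>x. f x \<partial>gauss_measure) \<le> (\<integral>x. g x \<partial>gauss_measure)"
  using assms
  by (intro integral_mono_AE integrable_bdd_meas) (auto intro: AE_mp [OF AE_irr_I])

lemma integral_transfer_op_nonneg:
  fixes f :: "real \<Rightarrow> real"
  assumes f: "bdd_meas f" and nn: "\<And>x. x \<in> irr_I \<Longrightarrow> 0 \<le> f x"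
  shows "(\<integral>x. transfer_op f x \<partial>gauss_measure) = (\<integral>x. f x \<partial>gauss_measure)"
proof -
  have [measurable]: "f \<in> borel_measurable borel" using f by (rule bdd_measD)
  have Pnn: "0 \<le> transfer_op f x" if "x \<in> irr_I" for x
    using transfer_op_mono [OF bdd_meas_const f that, of 0] nn that by (simp add: transfer_op_const)
  have "(\<integral>\<^sup>+x. ennreal (transfer_op f x) \<partial>gauss_measure)
    = (\<integral>\<^sup>+x. (\<Sum>i. ennreal (branch_weight i x) * ennreal (f (inv_branch i x))) \<partial>gauss_measure)"
  proof (rule nn_integral_cong_AE, rule AE_mp [OF AE_irr_I], rule AE_I2, rule impI)
    fix x assume x: "x \<in> irr_I"
    have "(\<Sum>i. ennreal (branch_weight i x * f (inv_branch i x)))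
      = ennreal (\<Sum>i. branch_weight i x * f (inv_branch i x))"
      using summable_transfer_op(2) [OF f x] branch_weight_pos [OF x] nn [OF inv_branch_irr_I [OF x]]
      by (intro suminf_ennreal2) (auto intro!: mult_nonneg_nonneg intro: less_imp_le)
    then show "ennreal (transfer_op f x)
        = (\<Sum>i. ennreal (branch_weight i x) * ennreal (f (inv_branch i x)))"
      using branch_weight_pos [OF x] nn [OF inv_branch_irr_I [OF x]]
      by (simp add: transfer_op_def ennreal_mult less_imp_le)
  qed
  also have "\<dots> = (\<integral>\<^sup>+x. ennreal (f x) \<partial>gauss_measure)"
    by (rule nn_integral_transfer) measurable
  finally have *: "(\<integral>\<^sup>+x. ennreal (transfer_op f x) \<partial>gauss_measure) = (\<integral>\<^sup>+x. ennreal (f x) \<partial>gauss_measure)" .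
  have "(\<integral>x. transfer_op f x \<partial>gauss_measure) = enn2real (\<integral>\<^sup>+x. ennreal (transfer_op f x) \<partial>gauss_measure)"
    by (rule integral_eq_nn_integral [OF measurable_gauss_measureI AE_mp [OF AE_irr_I AE_I2]])
      (use Pnn in auto)
  moreover have "(\<integral>x. f x \<partial>gauss_measure) = enn2real (\<integral>\<^sup>+x. ennreal (f x) \<partial>gauss_measure)"
    by (rule integral_eq_nn_integral [OF measurable_gauss_measureI AE_mp [OF AE_irr_I AE_I2]])
      (use nn in auto)
  ultimately show ?thesis
    by (simp only: *)
qed

lemma integral_transfer_op_real:
  fixes f :: "real \<Rightarrow> real"
  assumes f: "bdd_meas f"
  shows "(\<integral>x. transfer_op f x \<partial>gauss_measure) = (\<integral>x. f x \<partial>gauss_measure)"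
proof -
  obtain B where B: "\<And>x. x \<in> irr_I \<Longrightarrow> norm (f x) \<le> B" using bdd_measE [OF f] by metis
  have add: "(\<integral>x. g x + B \<partial>gauss_measure) = (\<integral>x. g x \<partial>gauss_measure) + B"
    if "bdd_meas g" for g
  proof -
    have "(\<integral>x. g x + B \<partial>gauss_measure) = (\<integral>x. g x \<partial>gauss_measure) + (\<integral>x. B \<partial>gauss_measure)"
      by (rule Bochner_Integration.integral_add) (simp_all add: integrable_bdd_meas that)
    then show ?thesis by (simp add: gauss.prob_space [simplified])
  qed
  have "(\<integral>x. f x \<partial>gauss_measure) + B = (\<integral>x. f x + B \<partial>gauss_measure)"
    by (rule add [OF f, symmetric])
  also have "\<dots> = (\<integral>x. transfer_op (\<lambda>y. f y + B) x \<partial>gauss_measure)"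
  proof (rule integral_transfer_op_nonneg [symmetric])
    show "0 \<le> f x + B" if "x \<in> irr_I" for x using B [OF that] by (simp add: abs_le_iff)
  qed (intro bdd_meas_intros f)
  also have "\<dots> = (\<integral>x. transfer_op f x + B \<partial>gauss_measure)"
  proof (rule integral_irr_I_cong)
    show "(\<lambda>x. transfer_op f x + B) \<in> borel_measurable borel"
      by (intro bdd_measD bdd_meas_intros f)
  qed (simp_all add: transfer_op_add transfer_op_const f bdd_meas_intros)
  also have "\<dots> = (\<integral>x. transfer_op f x \<partial>gauss_measure) + B"
    by (rule add [OF bdd_meas_transfer_op [OF f]])
  finally show ?thesis by simp
qed

lemma bdd_meas_Re: "bdd_meas f \<Longrightarrow> bdd_meas (\<lambda>x. Re (f x))"
  by (frule bdd_measD, erule bdd_measE, rule bdd_measI)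
    (auto intro: order_trans [OF abs_Re_le_cmod])

lemma bdd_meas_Im: "bdd_meas f \<Longrightarrow> bdd_meas (\<lambda>x. Im (f x))"
  by (frule bdd_measD, erule bdd_measE, rule bdd_measI)
    (auto intro: order_trans [OF abs_Im_le_cmod])

lemma integral_transfer_op_complex:
  fixes f :: "real \<Rightarrow> complex"
  assumes f: "bdd_meas f"
  shows "(\<integral>x. transfer_op f x \<partial>gauss_measure) = (\<integral>x. f x \<partial>gauss_measure)"
proof (rule complex_eqI)
  note int = integrable_bdd_meas [OF f] integrable_bdd_meas [OF bdd_meas_transfer_op [OF f]]
  have "Re (\<integral>x. transfer_op f x \<partial>gauss_measure) = (\<integral>x. Re (transfer_op f x) \<partial>gauss_measure)"
    by (simp add: int)
  also have "\<dots> = (\<integral>x. transfer_op (\<lambda>y. Re (f y)) x \<partial>gauss_measure)"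
    by (rule integral_irr_I_cong)
      (auto intro: bdd_meas_Re bdd_meas_transfer_op f bdd_measD simp: transfer_op_Re f)
  also have "\<dots> = Re (\<integral>x. f x \<partial>gauss_measure)"
    by (simp add: int integral_transfer_op_real bdd_meas_Re f)
  finally show "Re (\<integral>x. transfer_op f x \<partial>gauss_measure) = Re (\<integral>x. f x \<partial>gauss_measure)" .
  have "Im (\<integral>x. transfer_op f x \<partial>gauss_measure) = (\<integral>x. Im (transfer_op f x) \<partial>gauss_measure)"
    by (simp add: int)
  also have "\<dots> = (\<integral>x. transfer_op (\<lambda>y. Im (f y)) x \<partial>gauss_measure)"
    by (rule integral_irr_I_cong)
      (auto intro: bdd_meas_Im bdd_meas_transfer_op f bdd_measD simp: transfer_op_Im f)
  also have "\<dots> = Im (\<integral>x. f x \<partial>gauss_measure)"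
    by (simp add: int integral_transfer_op_real bdd_meas_Im f)
  finally show "Im (\<integral>x. transfer_op f x \<partial>gauss_measure) = Im (\<integral>x. f x \<partial>gauss_measure)" .
qed

lemma integral_mult_gauss_map_real:
  fixes f g :: "real \<Rightarrow> real"
  assumes "bdd_meas f" "bdd_meas g"
  shows "(\<integral>x. f x * g (gauss_map x) \<partial>gauss_measure) = (\<integral>x. transfer_op f x * g x \<partial>gauss_measure)"
proof -
  have "(\<integral>x. f x * g (gauss_map x) \<partial>gauss_measure)
     = (\<integral>x. transfer_op (\<lambda>x. f x * g (gauss_map x)) x \<partial>gauss_measure)"
    by (intro integral_transfer_op_real [symmetric] bdd_meas_intros assms)
  also have "\<dots> = (\<integral>x. transfer_op f x * g x \<partial>gauss_measure)"
    using assms by (intro integral_irr_I_cong bdd_meas_intros)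
      (auto intro!: bdd_measD bdd_meas_intros simp: transfer_op_mult_gauss_map)
  finally show ?thesis .
qed

lemma integral_mult_gauss_map_complex:
  fixes f g :: "real \<Rightarrow> complex"
  assumes "bdd_meas f" "bdd_meas g"
  shows "(\<integral>x. f x * g (gauss_map x) \<partial>gauss_measure) = (\<integral>x. transfer_op f x * g x \<partial>gauss_measure)"
proof -
  have "(\<integral>x. f x * g (gauss_map x) \<partial>gauss_measure)
     = (\<integral>x. transfer_op (\<lambda>x. f x * g (gauss_map x)) x \<partial>gauss_measure)"
    by (intro integral_transfer_op_complex [symmetric] bdd_meas_intros assms)
  also have "\<dots> = (\<integral>x. transfer_op f x * g x \<partial>gauss_measure)"
    using assms by (intro integral_irr_I_cong bdd_meas_intros)
      (auto intro!: bdd_measD bdd_meas_intros simp: transfer_op_mult_gauss_map)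
  finally show ?thesis .
qed

lemma integral_gauss_map_funpow:
  fixes f :: "real \<Rightarrow> real"
  assumes "bdd_meas f"
  shows "(\<integral>x. f ((gauss_map ^^ n) x) \<partial>gauss_measure) = (\<integral>x. f x \<partial>gauss_measure)"
proof (induction n)
  case (Suc n)
  have "(\<integral>x. f ((gauss_map ^^ Suc n) x) \<partial>gauss_measure)
     = (\<integral>x. 1 * f ((gauss_map ^^ n) (gauss_map x)) \<partial>gauss_measure)"
    by (simp only: funpow_Suc_right o_apply mult_1)
  also have "\<dots> = (\<integral>x. transfer_op (\<lambda>_. 1) x * f ((gauss_map ^^ n) x) \<partial>gauss_measure)"
    by (intro integral_mult_gauss_map_real bdd_meas_intros assms)
  also have "\<dots> = (\<integral>x. f ((gauss_map ^^ n) x) \<partial>gauss_measure)"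
    using assms by (intro integral_irr_I_cong bdd_meas_intros)
      (auto intro!: bdd_measD bdd_meas_intros simp: transfer_op_const)
  finally show ?case using Suc by simp
qed simp

section \<open>Contraction of oscillations\<close>

text \<open>
  The scale with respect to which Lipschitz constants are measured.  It is chosen so that
  \<open>branch_weight i x * phi (inv_branch i x)\<close> telescopes, which gives
  \<open>transfer_op phi x = 1 / (x + 1)\<close>.
\<close>

definition phi :: "real \<Rightarrow> real" where
  "phi x = x + x / (1 + x)"

text \<open>
  \<open>f\<close> is Lipschitz on \<^const>\<open>irr_I\<close> with constant \<open>L\<close> for the distance
  \<open>\<bar>phi x - phi y\<bar>\<close>; equivalently, \<open>L * phi + f\<close> and \<open>L * phi - f\<close> are both increasing.
\<close>

definition phi_lip :: "real \<Rightarrow> (real \<Rightarrow> real) \<Rightarrow> bool" where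
  "phi_lip L f \<longleftrightarrow> (\<forall>x\<in>irr_I. \<forall>y\<in>irr_I. x \<le> y \<longrightarrow> \<bar>f x - f y\<bar> \<le> L * (phi y - phi x))"

text \<open>
  Stochastic monotonicity.  The tail weights \<open>(x + 1) / (x + n + 1)\<close> increase with \<open>x\<close>, so a larger
  \<open>x\<close> shifts mass towards larger digits, that is towards smaller preimages, and it also makes each
  single preimage smaller.  Both effects decrease the average of an increasing function.
\<close>

lemma transfer_op_antimono:
  fixes g :: "real \<Rightarrow> real"
  assumes g: "bdd_meas g" and mono: "\<And>x y. x \<in> irr_I \<Longrightarrow> y \<in> irr_I \<Longrightarrow> x \<le> y \<Longrightarrow> g x \<le> g y"
    and x: "x \<in> irr_I" and y: "y \<in> irr_I" and xy: "x \<le> y"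
  shows "transfer_op g y \<le> transfer_op g x"
proof -
  have pos: "0 < x" "0 < y" using x y by (auto simp: irr_I_def)
  obtain B where B: "\<And>x. x \<in> irr_I \<Longrightarrow> \<bar>g x\<bar> \<le> B" using bdd_measE [OF g] by (metis real_norm_def)
  define b where "b i = g (inv_branch i x)" for i
  define e where "e n = (y + 1) / (y + real n + 1) - (x + 1) / (x + real n + 1)" for n
  have e_nonneg: "0 \<le> e n" for n
  proof -
    have "(x + 1) * (y + real n + 1) \<le> (y + 1) * (x + real n + 1)"
      using mult_right_mono [OF xy, of "real n"] by (simp add: algebra_simps)
    then show ?thesis
      using pos by (simp add: e_def field_simps)
  qed
  have e0: "e 0 = 0" using pos by (simp add: e_def)
  have b_anti: "b (Suc i) \<le> b i" for i
    unfolding b_def using x pos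
    by (intro mono inv_branch_irr_I) (auto simp: inv_branch_def intro!: divide_left_mono)
  have e_diff: "branch_weight i x - branch_weight i y = e (Suc i) - e i" for i
    using pos by (simp add: branch_weight_telescope e_def add_ac)
  \<comment> \<open>summation by parts, as an inequality for the partial sums\<close>
  have abel: "e n * b n \<le> (\<Sum>i<n. (e (Suc i) - e i) * b i)" for n
  proof (induction n)
    case (Suc n)
    have "e (Suc n) * b (Suc n) \<le> e (Suc n) * b n"
      by (intro mult_left_mono b_anti e_nonneg)
    also have "\<dots> = e n * b n + (e (Suc n) - e n) * b n" by (simp add: algebra_simps)
    finally show ?case using Suc by simp
  qed (simp add: e0)
  have sx: "(\<lambda>i. branch_weight i x * b i) sums transfer_op g x"
    using summable_transfer_op(2) [OF g x] by (simp add: b_def transfer_op_def summable_sums)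
  have "summable (\<lambda>i. branch_weight i y * B)"
    using branch_weight_sums [of y] pos by (intro summable_mult2) (auto simp: sums_iff)
  moreover have "norm (branch_weight i y * b i) \<le> branch_weight i y * B" for i
    using mult_left_mono [OF B [OF inv_branch_irr_I [OF x, of i]], of "branch_weight i y"]
      branch_weight_pos [OF y, of i] by (simp add: b_def abs_mult)
  ultimately have smy: "summable (\<lambda>i. branch_weight i y * b i)"
    by (rule summable_comparison_test' [where N = 0])
  have "(\<lambda>i. (e (Suc i) - e i) * b i) sums (transfer_op g x - (\<Sum>i. branch_weight i y * b i))"
    using sums_diff [OF sx summable_sums [OF smy]] by (simp flip: e_diff add: algebra_simps)
  then have lim: "(\<lambda>n. \<Sum>i<n. (e (Suc i) - e i) * b i)
      \<longlonglongrightarrow> transfer_op g x - (\<Sum>i. branch_weight i y * b i)"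
    by (simp add: sums_def)
  have "e \<longlonglongrightarrow> 0 - 0"
    unfolding e_def [abs_def] by (intro tendsto_diff tail_tendsto_0)
  then have "(\<lambda>n. e n * b n) \<longlonglongrightarrow> 0"
    using e_nonneg B [OF inv_branch_irr_I [OF x]]
    by (intro Lim_null_comparison [where g = "\<lambda>n. e n * B" and f = "\<lambda>n. e n * b n"]
        tendsto_mult_left_zero always_eventually allI)
      (simp_all add: abs_mult b_def mult_left_mono)
  from LIMSEQ_le [OF this lim] abel have "(\<Sum>i. branch_weight i y * b i) \<le> transfer_op g x" by auto
  moreover have "transfer_op g y \<le> (\<Sum>i. branch_weight i y * b i)"
    unfolding transfer_op_def real_scaleR_def
  proof (rule suminf_le)
    show "branch_weight i y * g (inv_branch i y) \<le> branch_weight i y * b i" for i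
      unfolding b_def using branch_weight_pos [OF y, of i] xy pos
      by (intro mult_left_mono mono inv_branch_irr_I x y)
        (auto simp: inv_branch_def intro!: divide_left_mono)
  qed (use summable_transfer_op(2) [OF g y] smy in auto)
  ultimately show ?thesis by simp
qed

lemma phi_diff_eq: "0 < x \<Longrightarrow> 0 < y \<Longrightarrow> phi y - phi x = (y - x) * (1 + 1 / ((1 + x) * (1 + y)))"
proof -
  assume xy: "0 < x" "0 < y"
  have "y / (1 + y) - x / (1 + x) = (y - x) * (1 / ((1 + x) * (1 + y)))"
    using xy by (simp add: field_simps)
  then show ?thesis by (simp add: phi_def distrib_left)
qed

lemma diff_le_phi_diff:
  assumes "0 < x" "x \<le> y"
  shows "y - x \<le> phi y - phi x"
proof -
  have "(y - x) * 1 \<le> (y - x) * (1 + 1 / ((1 + x) * (1 + y)))"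
    using assms by (intro mult_left_mono) auto
  then show ?thesis using assms by (simp add: phi_diff_eq)
qed

lemma phi_bounds: "x \<in> irr_I \<Longrightarrow> 0 \<le> phi x \<and> phi x \<le> 3 / 2"
proof -
  assume "x \<in> irr_I"
  then have x: "0 < x" "x < 1" by (auto simp: irr_I_def)
  then have "x / (1 + x) \<le> 1 / 2" "0 \<le> x / (1 + x)" by (auto simp: field_simps)
  moreover have "x + x / (1 + x) \<le> 1 + 1 / 2" using x calculation by linarith
  ultimately show ?thesis using x by (simp add: phi_def)
qed

lemma bdd_meas_phi: "bdd_meas phi"
proof (rule bdd_measI)
  show "phi \<in> borel_measurable borel" unfolding phi_def [abs_def] by measurable
  show "norm (phi x) \<le> 3 / 2" if "x \<in> irr_I" for x using phi_bounds [OF that] by auto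
qed

lemma transfer_op_phi:
  assumes "x \<in> irr_I" shows "transfer_op phi x = 1 / (x + 1)"
proof -
  define u where "u i = (x + 1) / (x + real i + 1)\<^sup>2" for i
  have x: "0 < x" using assms by (rule irr_I_pos)
  have *: "branch_weight i x * phi (inv_branch i x) = u i - u (Suc i)" for i
  proof -
    define a where "a = x + real i + 1"
    have a: "a > 0" using x by (simp add: a_def)
    have "c / (a * (a + 1)) * (1 / a + (1 / a) / (1 + 1 / a)) = c / a\<^sup>2 - c / (a + 1)\<^sup>2" for c
      using a by (simp add: divide_simps power2_eq_square) (simp add: algebra_simps)
    moreover have a1: "x + real i + 2 = a + 1" "x + real (Suc i) + 1 = a + 1" by (simp_all add: a_def)
    ultimately show ?thesis
      unfolding u_def branch_weight_def phi_def inv_branch_def a1 a_def [symmetric] by simp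
  qed
  have "u \<longlonglongrightarrow> 0" unfolding u_def [abs_def] by real_asymp
  from telescope_sums' [OF this] have "(\<lambda>i. branch_weight i x * phi (inv_branch i x)) sums u 0"
    by (simp add: *)
  moreover have "u 0 = 1 / (x + 1)" using x by (simp add: u_def power2_eq_square)
  ultimately show ?thesis by (simp add: transfer_op_def sums_iff)
qed

lemma phi_lipD: "phi_lip L f \<Longrightarrow> x \<in> irr_I \<Longrightarrow> y \<in> irr_I \<Longrightarrow> x \<le> y \<Longrightarrow> \<bar>f x - f y\<bar> \<le> L * (phi y - phi x)"
  by (simp add: phi_lip_def)

lemma phi_lip_osc:
  assumes "phi_lip L f" "L \<ge> 0" "x \<in> irr_I" "y \<in> irr_I"
  shows "\<bar>f x - f y\<bar> \<le> 3 / 2 * L"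
proof -
  have *: "\<bar>f x - f y\<bar> \<le> L * (3 / 2)" if "x \<le> y" "x \<in> irr_I" "y \<in> irr_I" for x y
    using phi_lipD [OF assms(1) that(2,3,1)] phi_bounds [of x] phi_bounds [of y] that
      mult_left_mono [of "phi y - phi x" "3/2" L] assms(2) by auto
  show ?thesis
    using *[of x y] *[of y x] assms(3,4) by (cases "x \<le> y") (auto simp: abs_minus_commute)
qed

text \<open>
  The contraction: apply \<open>transfer_op_antimono\<close> to the increasing functions \<open>L * phi + f\<close> and
  \<open>L * phi - f\<close>, and compare the decrease of \<open>1 / (x + 1)\<close> with half the increase of \<^const>\<open>phi\<close>.
\<close>

lemma phi_lip_transfer_op:
  assumes f: "bdd_meas f" and L: "phi_lip L f" "L \<ge> 0"
  shows "phi_lip (L / 2) (transfer_op f)"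
  unfolding phi_lip_def
proof (intro ballI impI)
  fix x y assume x: "x \<in> irr_I" and y: "y \<in> irr_I" and xy: "x \<le> y"
  have pos: "0 < x" "0 < y" using x y by (auto simp: irr_I_def)
  have L_phi: "bdd_meas (\<lambda>z. L * phi z)"
    by (intro bdd_meas_intros bdd_meas_phi)
  have 1: "transfer_op (\<lambda>z. L * phi z + f z) y \<le> transfer_op (\<lambda>z. L * phi z + f z) x"
    by (rule transfer_op_antimono [OF bdd_meas_add [OF L_phi f] _ x y xy])
      (use phi_lipD [OF L(1)] in \<open>force simp: abs_le_iff algebra_simps\<close>)
  have 2: "transfer_op (\<lambda>z. L * phi z - f z) y \<le> transfer_op (\<lambda>z. L * phi z - f z) x"
    by (rule transfer_op_antimono [OF bdd_meas_diff [OF L_phi f] _ x y xy])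
      (use phi_lipD [OF L(1)] in \<open>force simp: abs_le_iff algebra_simps\<close>)
  have "\<bar>transfer_op f x - transfer_op f y\<bar> \<le> L * (1 / (x + 1) - 1 / (y + 1))"
    using 1 2 x y f L_phi
    by (simp add: transfer_op_add transfer_op_diff transfer_op_mult_left bdd_meas_phi transfer_op_phi
        right_diff_distrib abs_le_iff)
  also have "\<dots> \<le> L * ((phi y - phi x) / 2)"
  proof (rule mult_left_mono)
    have "1 / (x + 1) - 1 / (y + 1) = (y - x) * (1 / ((1 + x) * (1 + y)))"
      using pos by (simp add: field_simps)
    also have "\<dots> \<le> (y - x) * ((1 + 1 / ((1 + x) * (1 + y))) / 2)"
    proof (rule mult_left_mono)
      have "1 / ((1 + x) * (1 + y)) \<le> 1 / (1 * 1)"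
        using pos by (intro divide_left_mono mult_mono) auto
      then show "1 / ((1 + x) * (1 + y)) \<le> (1 + 1 / ((1 + x) * (1 + y))) / 2" by simp
    qed (use xy in simp)
    also have "\<dots> = (phi y - phi x) / 2" by (simp add: phi_diff_eq pos)
    finally show "1 / (x + 1) - 1 / (y + 1) \<le> (phi y - phi x) / 2" .
  qed fact
  finally show "\<bar>transfer_op f x - transfer_op f y\<bar> \<le> L / 2 * (phi y - phi x)" by simp
qed

section \<open>Regularity of the branch weights and digit functions\<close>

lemma branch_weight_diff_eq:
  assumes "0 < x" "0 < y"
  shows "branch_weight i x - branch_weight i y
    = (x - y) * ((real i + 1)\<^sup>2 - (real i + 1) - 1 - x * y - x - y)
      / (((x + real i + 1) * (x + real i + 2)) * ((y + real i + 1) * (y + real i + 2)))"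
proof -
  define P where "P z = (z + real i + 1) * (z + real i + 2)" for z
  have P: "P x > 0" "P y > 0" using assms by (simp_all add: P_def)
  have "(x + 1) / P x - (y + 1) / P y = ((x + 1) * P y - (y + 1) * P x) / (P x * P y)"
    using P by (simp add: diff_frac_eq)
  also have "(x + 1) * P y - (y + 1) * P x = (x - y) * ((real i + 1)\<^sup>2 - (real i + 1) - 1 - x * y - x - y)"
    by (simp add: P_def algebra_simps power2_eq_square)
  finally show ?thesis by (simp add: branch_weight_def P_def)
qed

lemma branch_weight_diff_le:
  assumes "x \<in> irr_I" "y \<in> irr_I"
  shows "\<bar>branch_weight i x - branch_weight i y\<bar> \<le> \<bar>x - y\<bar> * branch_weight i x"
proof -
  have x: "0 < x" "x < 1" and y: "0 < y" "y < 1" using assms by (auto simp: irr_I_def)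
  define j where "j = real i + 1"
  have j: "j \<ge> 1" by (simp add: j_def)
  define P where "P z = (z + real i + 1) * (z + real i + 2)" for z
  define N where "N = j\<^sup>2 - j - 1 - x * y - x - y"
  have P: "P x > 0" "P y > 0" using x y by (simp_all add: P_def)
  have Py: "j\<^sup>2 + j \<le> P y" using y by (simp add: P_def j_def algebra_simps power2_eq_square)
  have bw: "branch_weight i z = (z + 1) / P z" for z
    by (simp add: branch_weight_def P_def)
  have "branch_weight i x - branch_weight i y = (x - y) * N / (P x * P y)"
    unfolding branch_weight_diff_eq [OF x(1) y(1)] by (simp add: P_def N_def j_def)
  then have eq: "\<bar>branch_weight i x - branch_weight i y\<bar> = \<bar>x - y\<bar> * \<bar>N\<bar> / (P x * P y)"
    using P by (simp add: abs_mult)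
  have "\<bar>N\<bar> \<le> (x + 1) * P y"
  proof (rule abs_leI)
    have "N \<le> P y" 
      unfolding N_def using Py j mult_pos_pos [OF x(1) y(1)] x y by linarith
    also have "\<dots> \<le> (x + 1) * P y" using P x by simp
    finally show "N \<le> (x + 1) * P y" .
    have "j \<le> j\<^sup>2" using j by (simp add: power2_eq_square)
    then have "- N \<le> (x + 1) * (y + 1)" by (simp add: N_def algebra_simps)
    also have "\<dots> \<le> (x + 1) * P y" using x y j Py \<open>j \<le> j\<^sup>2\<close> by (intro mult_left_mono) auto
    finally show "- N \<le> (x + 1) * P y" .
  qed
  then have "\<bar>x - y\<bar> * \<bar>N\<bar> / (P x * P y) \<le> \<bar>x - y\<bar> * ((x + 1) * P y) / (P x * P y)"
    using P by (intro divide_right_mono mult_left_mono) auto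
  also have "\<dots> = \<bar>x - y\<bar> * branch_weight i x" using P by (simp add: bw)
  finally show ?thesis using eq by simp
qed

text \<open>
  Bounded distortion: the digit distribution given \<open>y\<close> is dominated by three times the one given
  \<open>x\<close>.
\<close>

lemma branch_weight_ratio:
  assumes "x \<in> irr_I" "y \<in> irr_I"
  shows "branch_weight i y \<le> 3 * branch_weight i x"
proof -
  have x: "0 < x" "x < 1" and y: "0 < y" "y < 1" using assms by (auto simp: irr_I_def)
  define j where "j = real i + 1"
  have j: "j \<ge> 1" by (simp add: j_def)
  have "(y + 1) * (x + j) * (x + j + 1) \<le> 3 * (x + 1) * (y + j) * (y + j + 1)"
  proof -
    have "x + j \<le> (x + 1) * j" using x j by (simp add: algebra_simps)
    then have 1: "(y + 1) * (x + j) \<le> (y + 1) * ((x + 1) * j)"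
      using y by (intro mult_left_mono) auto
    have "y * j \<le> 1 * j" using y j by (intro mult_right_mono) auto
    then have "(y + 1) * j \<le> 2 * (y + j)" using y unfolding distrib_right distrib_left by linarith
    then have 2: "(x + 1) * ((y + 1) * j) \<le> (x + 1) * (2 * (y + j))"
      using x by (intro mult_left_mono) auto
    have "(y + 1) * (x + j) \<le> 2 * ((x + 1) * (y + j))"
      using 1 2 by (simp only: mult_ac)
    moreover have "x + j + 1 \<le> 3 / 2 * (y + j + 1)" using x y j by simp
    ultimately have "((y + 1) * (x + j)) * (x + j + 1) \<le> (2 * ((x + 1) * (y + j))) * (3 / 2 * (y + j + 1))"
      by (rule mult_mono) (use x y j in auto)
    also have "\<dots> = 3 * (x + 1) * (y + j) * (y + j + 1)"
    proof -
      have "(2 * A) * (3 / 2 * B) = 3 * (A * B)" for A B :: real by simp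
      then show ?thesis by (simp only: mult.assoc)
    qed
    finally show ?thesis .
  qed
  then have "(y + 1) * ((x + j) * (x + j + 1)) \<le> 3 * (x + 1) * ((y + j) * (y + j + 1))"
    by (simp only: mult.assoc)
  moreover have "0 < (x + j) * (x + j + 1)" "0 < (y + j) * (y + j + 1)" using x y j by auto
  moreover have "b / Y \<le> 3 * (a / X)" if "b * X \<le> 3 * a * Y" "0 < X" "0 < Y" for a b X Y :: real
    using that by (simp add: field_simps)
  ultimately have "(y + 1) / ((y + j) * (y + j + 1)) \<le> 3 * ((x + 1) / ((x + j) * (x + j + 1)))"
    by blast
  moreover have "x + real i + 1 = x + j" "x + real i + 2 = x + j + 1"
    "y + real i + 1 = y + j" "y + real i + 2 = y + j + 1" by (simp_all add: j_def)
  ultimately show ?thesis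
    unfolding branch_weight_def by (simp only:)
qed

text \<open>
  Only the variation of \<open>f\<close> inside each branch enters, so \<open>f\<close> may jump between branches.  For
  functions of the first digit \<open>K = 0\<close>.
\<close>

lemma transfer_op_diff_bound:
  fixes f :: "real \<Rightarrow> real"
  assumes f: "bdd_meas f" and x: "x \<in> irr_I" and y: "y \<in> irr_I"
    and K: "\<And>i. \<bar>f (inv_branch i x) - f (inv_branch i y)\<bar> \<le> K"
  shows "\<bar>transfer_op f x - transfer_op f y\<bar> \<le> \<bar>x - y\<bar> * transfer_op (\<lambda>z. \<bar>f z\<bar>) x + K"
proof -
  have af: "bdd_meas (\<lambda>z. \<bar>f z\<bar>)" by (intro bdd_meas_intros f)
  have sums: "(\<lambda>i. branch_weight i x * f (inv_branch i x) - branch_weight i y * f (inv_branch i y))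
      sums (transfer_op f x - transfer_op f y)"
    using summable_transfer_op(2) [OF f x] summable_transfer_op(2) [OF f y]
    by (intro sums_diff) (auto simp: transfer_op_def summable_sums)
  have "(\<lambda>i. \<bar>x - y\<bar> * (branch_weight i x * \<bar>f (inv_branch i x)\<bar>) + branch_weight i y * K)
      sums (\<bar>x - y\<bar> * transfer_op (\<lambda>z. \<bar>f z\<bar>) x + 1 * K)"
    using summable_transfer_op(2) [OF af x] irr_I_pos [OF y]
    by (intro sums_add sums_mult sums_mult2 branch_weight_sums)
      (auto simp: transfer_op_def summable_sums)
  then have bound: "(\<lambda>i. \<bar>x - y\<bar> * (branch_weight i x * \<bar>f (inv_branch i x)\<bar>) + branch_weight i y * K)
      sums (\<bar>x - y\<bar> * transfer_op (\<lambda>z. \<bar>f z\<bar>) x + K)"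
    by simp
  have "norm (branch_weight i x * f (inv_branch i x) - branch_weight i y * f (inv_branch i y))
     \<le> \<bar>x - y\<bar> * (branch_weight i x * \<bar>f (inv_branch i x)\<bar>) + branch_weight i y * K" for i
  proof -
    have "branch_weight i x * f (inv_branch i x) - branch_weight i y * f (inv_branch i y)
      = (branch_weight i x - branch_weight i y) * f (inv_branch i x)
        + branch_weight i y * (f (inv_branch i x) - f (inv_branch i y))"
      by (simp add: algebra_simps)
    also have "norm \<dots> \<le> \<bar>branch_weight i x - branch_weight i y\<bar> * \<bar>f (inv_branch i x)\<bar>
        + branch_weight i y * \<bar>f (inv_branch i x) - f (inv_branch i y)\<bar>"
      using branch_weight_pos [OF y, of i] by (auto simp: abs_mult intro: order_trans [OF abs_triangle_ineq])
    also have "\<dots> \<le> (\<bar>x - y\<bar> * branch_weight i x) * \<bar>f (inv_branch i x)\<bar> + branch_weight i y * K"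
      using branch_weight_pos [OF y, of i] K
      by (intro add_mono mult_right_mono mult_left_mono branch_weight_diff_le x y) auto
    finally show ?thesis by (simp add: mult_ac)
  qed
  with norm_sums_le [OF sums bound] show ?thesis by simp
qed

text \<open>
  Functions that depend, on \<^const>\<open>irr_I\<close>, on the first continued fraction digit only.
\<close>

definition digit_fun :: "(real \<Rightarrow> real) \<Rightarrow> bool" where
  "digit_fun f \<longleftrightarrow> (\<forall>i. \<forall>x\<in>irr_I. \<forall>y\<in>irr_I. f (inv_branch i x) = f (inv_branch i y))"

lemma digit_funD: "digit_fun f \<Longrightarrow> x \<in> irr_I \<Longrightarrow> y \<in> irr_I \<Longrightarrow> f (inv_branch i x) = f (inv_branch i y)"
  unfolding digit_fun_def by blast

lemma digit_fun_comp: "digit_fun f \<Longrightarrow> digit_fun (\<lambda>x. g (f x))"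
  unfolding digit_fun_def by metis

lemma transfer_op_digit_fun_le:
  assumes f: "bdd_meas f" "digit_fun f" and nn: "\<And>x. x \<in> irr_I \<Longrightarrow> 0 \<le> f x" and y: "y \<in> irr_I"
  shows "transfer_op f y \<le> 3 * (\<integral>x. f x \<partial>gauss_measure)"
proof -
  have le: "transfer_op f y \<le> 3 * transfer_op f x" if x: "x \<in> irr_I" for x
  proof -
    have "transfer_op f y \<le> (\<Sum>i. 3 * (branch_weight i x *\<^sub>R f (inv_branch i x)))"
      unfolding transfer_op_def
    proof (rule suminf_le)
      fix i
      have "f (inv_branch i y) = f (inv_branch i x)" by (rule digit_funD [OF f(2) y x])
      then show "branch_weight i y *\<^sub>R f (inv_branch i y) \<le> 3 * (branch_weight i x *\<^sub>R f (inv_branch i x))"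
        using mult_right_mono [OF branch_weight_ratio [OF x y, of i] nn [OF inv_branch_irr_I [OF x, of i]]]
        by simp
    qed (rule summable_transfer_op(2) [OF f(1) y] summable_mult [OF summable_transfer_op(2) [OF f(1) x]])+
    also have "\<dots> = 3 * transfer_op f x"
      unfolding transfer_op_def by (rule suminf_mult [OF summable_transfer_op(2) [OF f(1) x]])
    finally show ?thesis .
  qed
  have "transfer_op f y = (\<integral>x. transfer_op f y \<partial>gauss_measure)"
    by (simp add: gauss.prob_space [simplified])
  also have "\<dots> \<le> (\<integral>x. 3 * transfer_op f x \<partial>gauss_measure)"
    by (intro integral_irr_I_mono bdd_meas_intros f le)
  also have "\<dots> = 3 * (\<integral>x. f x \<partial>gauss_measure)"
    using integral_transfer_op_real [OF f(1)] by simp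
  finally show ?thesis .
qed

lemma phi_lip_transfer_op_digit_fun:
  assumes f: "bdd_meas f" "digit_fun f"
  shows "phi_lip (3 * (\<integral>x. \<bar>f x\<bar> \<partial>gauss_measure)) (transfer_op f)"
  unfolding phi_lip_def
proof (intro ballI impI)
  fix x y assume x: "x \<in> irr_I" and y: "y \<in> irr_I" and xy: "x \<le> y"
  have "\<bar>transfer_op f x - transfer_op f y\<bar> \<le> \<bar>x - y\<bar> * transfer_op (\<lambda>z. \<bar>f z\<bar>) x + 0"
    by (rule transfer_op_diff_bound [OF f(1) x y]) (simp add: digit_funD [OF f(2) x y])
  also have "\<dots> \<le> (phi y - phi x) * (3 * (\<integral>x. \<bar>f x\<bar> \<partial>gauss_measure)) + 0"
  proof (intro add_mono mult_mono order_refl)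
    show "\<bar>x - y\<bar> \<le> phi y - phi x" using diff_le_phi_diff [OF irr_I_pos [OF x] xy] xy by simp
    then show "0 \<le> phi y - phi x" by simp
    show "transfer_op (\<lambda>z. \<bar>f z\<bar>) x \<le> 3 * (\<integral>x. \<bar>f x\<bar> \<partial>gauss_measure)"
      by (rule transfer_op_digit_fun_le
          [OF bdd_meas_abs [OF f(1)] digit_fun_comp [OF f(2), where g = abs] _ x]) simp
    show "0 \<le> transfer_op (\<lambda>z. \<bar>f z\<bar>) x"
      using transfer_op_mono [OF bdd_meas_const bdd_meas_abs [OF f(1)] x, of 0] x
      by (simp add: transfer_op_const)
  qed
  finally show "\<bar>transfer_op f x - transfer_op f y\<bar>
      \<le> 3 * (\<integral>x. \<bar>f x\<bar> \<partial>gauss_measure) * (phi y - phi x)"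
    by (simp add: mult_ac)
qed

text \<open>
  The indicator of the event that the first digit lies in \<open>D\<close>.
\<close>

definition digit_event :: "int set \<Rightarrow> real \<Rightarrow> real" where
  "digit_event D x = indicator D \<lfloor>1 / x\<rfloor>"

lemma digit_event_measurable [measurable]: "digit_event D \<in> borel_measurable borel"
  unfolding digit_event_def [abs_def] by measurable

lemma digit_event_inv_branch: "x \<in> irr_I \<Longrightarrow> digit_event D (inv_branch i x) = indicator D (int i + 1)"
  by (simp add: digit_event_def floor_inverse_inv_branch)

lemma bdd_meas_digit_event [simp]: "bdd_meas (digit_event D)"
  by (rule bdd_measI [where B = 1]) (auto simp: digit_event_def indicator_def)

lemma transfer_op_digit_tail:
  assumes x: "x \<in> irr_I"
  shows "transfer_op (digit_event {int n<..}) x = (x + 1) / (x + real n + 1)"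
proof -
  have "transfer_op (digit_event {int n<..}) x + (\<Sum>i<n. branch_weight i x) = 1"
  proof -
    have eq: "transfer_op (digit_event {int n<..}) x = (\<Sum>i. branch_weight i x * indicator {int n<..} (int i + 1))"
      using x by (simp add: transfer_op_def digit_event_inv_branch)
    have sm: "summable (\<lambda>i. branch_weight i x * indicator {int n<..} (int i + 1))"
      using summable_transfer_op(2) [OF bdd_meas_digit_event x] x by (simp add: digit_event_inv_branch)
    have "(\<Sum>i. branch_weight i x * indicator {int n<..} (int i + 1))
      = (\<Sum>i. branch_weight (i + n) x * indicator {int n<..} (int (i + n) + 1))
        + (\<Sum>i<n. branch_weight i x * indicator {int n<..} (int i + 1))"
      by (rule suminf_split_initial_segment [OF sm])
    also have "\<dots> = (\<Sum>i. branch_weight (i + n) x)" by (simp add: indicator_def)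
    finally show ?thesis
      using suminf_split_initial_segment [of "\<lambda>i. branch_weight i x" n]
        branch_weight_sums [of x] irr_I_pos [OF x] by (simp add: eq sums_iff)
  qed
  then show ?thesis using irr_I_pos [OF x] by (simp add: sum_branch_weight)
qed

text \<open>
  The weight of the digit \<open>1\<close> decreases with \<open>x\<close> and those of the digits \<open>\<ge> 3\<close> increase, so the
  increase is at most that for a tail \<open>{2..}\<close> or \<open>{3..}\<close> (depending on the sign for the
  digit \<open>2\<close>), for which the transfer operator is explicit.
\<close>

lemma digit_event_increment_bound:
  assumes x: "x \<in> irr_I" and y: "y \<in> irr_I" and xy: "x \<le> y"
  shows "transfer_op (digit_event D) y - transfer_op (digit_event D) x \<le> 1 / 8 * (phi y - phi x)"
proof -
  have px: "0 < x" "x < 1" and py: "0 < y" "y < 1" using x y by (auto simp: irr_I_def)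
  define d where "d i = branch_weight i y - branch_weight i x" for i
  define n :: nat where "n = (if 0 \<le> d 1 then 1 else 2)"
  have d_sums: "(\<lambda>i. d i * indicator D (int i + 1)) sums
      (transfer_op (digit_event D) y - transfer_op (digit_event D) x)" for D
  proof -
    have "(\<lambda>i. branch_weight i z * indicator D (int i + 1)) sums transfer_op (digit_event D) z"
      if "z \<in> irr_I" for z
      using summable_transfer_op(2) [OF bdd_meas_digit_event that, THEN summable_sums] that
      by (simp add: transfer_op_def digit_event_inv_branch)
    from sums_diff [OF this [OF y] this [OF x]] show ?thesis by (simp add: d_def algebra_simps)
  qed
  have d0: "d 0 \<le> 0"
  proof -
    have "0 < y * x" using px py by simp
    moreover have "(real 0 + 1)\<^sup>2 - (real 0 + 1) - 1 - y * x - y - x = - 1 - y * x - y - x" by simp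
    ultimately have "(real 0 + 1)\<^sup>2 - (real 0 + 1) - 1 - y * x - y - x \<le> 0"
      using px py by linarith
    then show ?thesis
      unfolding d_def branch_weight_diff_eq [OF py(1) px(1)]
      using px py xy by (intro divide_nonpos_pos mult_nonneg_nonpos mult_pos_pos) auto
  qed
  have d2: "0 \<le> d i" if "i \<ge> 2" for i
  proof -
    have "3 * (real i + 1) \<le> (real i + 1) * (real i + 1)"
      using that by (intro mult_right_mono) auto
    moreover have "y * x \<le> 1 * 1" using px py by (intro mult_mono) auto
    ultimately have "0 \<le> (real i + 1)\<^sup>2 - (real i + 1) - 1 - y * x - y - x"
      using that px py by (simp add: power2_eq_square)
    then show ?thesis
      unfolding d_def branch_weight_diff_eq [OF py(1) px(1)]
      using px py xy by (intro divide_nonneg_pos mult_nonneg_nonneg) auto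
  qed
  have le: "d i * indicator D (int i + 1) \<le> d i * indicator {int n<..} (int i + 1)" for i
  proof -
    consider "i = 0" | "i = 1" | "i \<ge> 2" by linarith
    then show ?thesis
    proof cases
      case 1
      then show ?thesis using d0 by (simp add: n_def indicator_def)
    next
      case 2
      then show ?thesis by (simp add: n_def indicator_def)
    next
      case 3
      then show ?thesis using d2 [of i] by (simp add: n_def indicator_def)
    qed
  qed
  from sums_le [OF le d_sums d_sums]
  have "transfer_op (digit_event D) y - transfer_op (digit_event D) x
      \<le> (y + 1) / (y + real n + 1) - (x + 1) / (x + real n + 1)"
    by (simp add: transfer_op_digit_tail x y)
  also have "\<dots> = (y - x) * (real n / ((y + real n + 1) * (x + real n + 1)))"
    using px py by (simp add: diff_frac_eq) (simp add: algebra_simps)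
  also have "\<dots> \<le> (y - x) * (1 / 8 * (1 + 1 / ((1 + x) * (1 + y))))"
  proof (rule mult_left_mono)
    \<comment> \<open>two applications of the inequality between arithmetic and geometric means\<close>
    define s where "s = sqrt ((1 + x) * (1 + y))"
    have s2: "s\<^sup>2 = (1 + x) * (1 + y)" using px py by (simp add: s_def)
    have s: "s > 0" using px py by (simp add: s_def)
    have "2 * s \<le> (1 + x) + (1 + y)"
      using arith_geo_mean_sqrt [of "1 + x" "1 + y"] px py by (simp add: s_def)
    then have "(s + real n)\<^sup>2 \<le> (y + real n + 1) * (x + real n + 1)"
      using s2 mult_left_mono [of "2 * s" "(1 + x) + (1 + y)" "real n"]
      by (simp add: power2_eq_square algebra_simps)
    moreover have "4 * (s * real n) \<le> (s + real n)\<^sup>2"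
      using zero_le_power2 [of "s - real n"] by (simp add: power2_eq_square algebra_simps)
    ultimately have *: "4 * (s * real n) \<le> (y + real n + 1) * (x + real n + 1)" by simp
    have n: "real n > 0" by (simp add: n_def)
    have "real n / ((y + real n + 1) * (x + real n + 1)) \<le> real n / (4 * (s * real n))"
      using * s n px py by (intro divide_left_mono) auto
    also have "\<dots> = 1 / 8 * (2 / s)" using n by simp
    also have "2 / s \<le> 1 + 1 / s\<^sup>2"
      using zero_le_power2 [of "1 - 1 / s"] s by (simp add: power2_diff power_divide)
    finally show "real n / ((y + real n + 1) * (x + real n + 1)) \<le> 1 / 8 * (1 + 1 / ((1 + x) * (1 + y)))"
      by (simp add: s2)
  qed (use xy in simp)
  also have "\<dots> = 1 / 8 * (phi y - phi x)" using px py by (simp add: phi_diff_eq)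
  finally show ?thesis .
qed

lemma phi_lip_digit_event: "phi_lip (1 / 8) (transfer_op (digit_event D))"
  unfolding phi_lip_def
proof (intro ballI impI)
  fix x y assume x: "x \<in> irr_I" and y: "y \<in> irr_I" and xy: "x \<le> y"
  have compl: "transfer_op (digit_event (- D)) z = 1 - transfer_op (digit_event D) z" if "z \<in> irr_I" for z
  proof -
    have "digit_event (- D) = (\<lambda>z. 1 - digit_event D z)"
      by (auto simp: digit_event_def indicator_def)
    then show ?thesis using that by (simp add: transfer_op_diff transfer_op_const)
  qed
  show "\<bar>transfer_op (digit_event D) x - transfer_op (digit_event D) y\<bar> \<le> 1 / 8 * (phi y - phi x)"
    using digit_event_increment_bound [OF x y xy, of D] digit_event_increment_bound [OF x y xy, of "- D"]
    unfolding compl [OF x] compl [OF y] by (intro abs_leI) linarith+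
qed

section \<open>Orbit sums of a sequence of functions\<close>

lemma phi_lipI:
  "(\<And>x y. x \<in> irr_I \<Longrightarrow> y \<in> irr_I \<Longrightarrow> x \<le> y \<Longrightarrow> \<bar>f x - f y\<bar> \<le> L * (phi y - phi x)) \<Longrightarrow> phi_lip L f"
  by (simp add: phi_lip_def)

lemma phi_mono: "x \<in> irr_I \<Longrightarrow> x \<le> y \<Longrightarrow> phi x \<le> phi y"
  using diff_le_phi_diff [of x y] irr_I_pos [of x] by simp

lemma phi_lip_mono: "phi_lip L f \<Longrightarrow> L \<le> M \<Longrightarrow> phi_lip M f"
  by (rule phi_lipI, drule (3) phi_lipD, erule order_trans) (auto intro!: mult_right_mono phi_mono)

lemma phi_lip_add: 
  assumes "phi_lip L f" "phi_lip M g" shows "phi_lip (L + M) (\<lambda>x. f x + g x)"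
proof (rule phi_lipI)
  fix x y assume xy: "x \<in> irr_I" "y \<in> irr_I" "x \<le> y"
  have "\<bar>(f x + g x) - (f y + g y)\<bar> \<le> \<bar>f x - f y\<bar> + \<bar>g x - g y\<bar>" by linarith
  also have "\<dots> \<le> L * (phi y - phi x) + M * (phi y - phi x)"
    by (intro add_mono phi_lipD assms xy)
  finally show "\<bar>(f x + g x) - (f y + g y)\<bar> \<le> (L + M) * (phi y - phi x)"
    by (simp add: distrib_right)
qed

lemma phi_lip_cong: "phi_lip L f \<Longrightarrow> (\<And>x. x \<in> irr_I \<Longrightarrow> f x = g x) \<Longrightarrow> phi_lip L g"
  by (simp add: phi_lip_def)

text \<open>
  A \<^const>\<open>phi_lip\<close> function stays within half its oscillation of the midpoint of its range.
  Centring there saves the factor two that the variance bound needs.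
\<close>

lemma phi_lip_centre:
  assumes h: "bdd_meas h" "phi_lip L h" "L \<ge> 0"
  obtains c where "\<And>x. x \<in> irr_I \<Longrightarrow> \<bar>h x - c\<bar> \<le> 3 / 4 * L"
proof (cases "irr_I = {}")
  case False
  obtain B where "\<And>x. x \<in> irr_I \<Longrightarrow> \<bar>h x\<bar> \<le> B" using bdd_measE [OF h(1)] by (metis real_norm_def)
  then have bdd: "bdd_above (h ` irr_I)" "bdd_below (h ` irr_I)"
    by (auto intro!: bdd_aboveI2 [of _ _ B] bdd_belowI2 [of _ "- B"] simp: abs_le_iff minus_le_iff)
  define s i where "s = Sup (h ` irr_I)" and "i = Inf (h ` irr_I)"
  have hs: "h x \<le> s" and hi: "i \<le> h x" if "x \<in> irr_I" for x
    using that bdd by (auto simp: s_def i_def intro: cSUP_upper cINF_lower)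
  have *: "s \<le> h y + 3 / 2 * L" if y: "y \<in> irr_I" for y
    unfolding s_def
  proof (rule cSUP_least [OF False])
    show "h x \<le> h y + 3 / 2 * L" if "x \<in> irr_I" for x
      using phi_lip_osc [OF h(2,3) that y] by linarith
  qed
  have "s - 3 / 2 * L \<le> i"
    unfolding i_def using False * by (intro cINF_greatest) (auto simp: algebra_simps)
  then have "\<bar>h x - (s + i) / 2\<bar> \<le> 3 / 4 * L" if "x \<in> irr_I" for x
    using hs [OF that] hi [OF that] by (intro abs_leI) (simp_all add: field_simps)
  then show ?thesis by (rule that)
qed (use that in auto)

lemma integral_centred_mult_bound:
  fixes f :: "real \<Rightarrow> real"
  assumes h: "bdd_meas h" "phi_lip L h" "L \<ge> 0" and f: "bdd_meas f" "(\<integral>x. f x \<partial>gauss_measure) = 0"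
  shows "\<bar>\<integral>x. h x * f x \<partial>gauss_measure\<bar> \<le> 3 / 4 * L * (\<integral>x. \<bar>f x\<bar> \<partial>gauss_measure)"
proof -
  obtain c where c: "\<And>x. x \<in> irr_I \<Longrightarrow> \<bar>h x - c\<bar> \<le> 3 / 4 * L" using phi_lip_centre [OF h] by metis
  have int: "integrable gauss_measure (\<lambda>x. h x * f x)" "integrable gauss_measure (\<lambda>x. c * f x)"
    by (intro integrable_bdd_meas bdd_meas_mult h f bdd_meas_const)+
  have "(\<integral>x. h x * f x \<partial>gauss_measure) = (\<integral>x. h x * f x - c * f x \<partial>gauss_measure)"
    using int f(2) by simp
  also have "\<bar>\<dots>\<bar> \<le> (\<integral>x. \<bar>h x * f x - c * f x\<bar> \<partial>gauss_measure)"
    by (rule integral_abs_bound)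
  also have "\<dots> \<le> (\<integral>x. 3 / 4 * L * \<bar>f x\<bar> \<partial>gauss_measure)"
  proof (rule integral_irr_I_mono)
    show "\<bar>h x * f x - c * f x\<bar> \<le> 3 / 4 * L * \<bar>f x\<bar>" if "x \<in> irr_I" for x
      unfolding left_diff_distrib [symmetric] abs_mult by (intro mult_right_mono c that) simp
  qed (intro bdd_meas_abs bdd_meas_diff bdd_meas_mult h f bdd_meas_const)+
  finally show ?thesis by simp
qed

lemma phi_lip_mean_zero_bound:
  assumes h: "bdd_meas h" "phi_lip L h" "L \<ge> 0" and mean: "(\<integral>x. h x \<partial>gauss_measure) = 0"
    and x: "x \<in> irr_I"
  shows "\<bar>h x\<bar> \<le> 3 / 2 * L"
proof -
  have int: "integrable gauss_measure h" by (rule integrable_bdd_meas) fact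
  have "h x = (\<integral>y. h x - h y \<partial>gauss_measure)"
    using int mean by (simp add: gauss.prob_space [simplified])
  also have "\<bar>\<dots>\<bar> \<le> (\<integral>y. \<bar>h x - h y\<bar> \<partial>gauss_measure)"
    by (rule integral_abs_bound)
  also have "\<dots> \<le> (\<integral>y. 3 / 2 * L \<partial>gauss_measure)"
    by (rule integral_irr_I_mono)
      (intro bdd_meas_abs bdd_meas_diff h bdd_meas_const phi_lip_osc x | assumption)+
  finally show ?thesis by (simp add: gauss.prob_space [simplified])
qed

text \<open>
  The recursion satisfied by the Lipschitz constants of iterated averages when the operator halves
  them: \<open>discounted_sum c n\<close> is the sum of \<open>c k / 2 ^ (n - 1 - k)\<close> over \<open>k < n\<close>.
\<close>

primrec discounted_sum :: "(nat \<Rightarrow> real) \<Rightarrow> nat \<Rightarrow> real" where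
  "discounted_sum c 0 = 0"
| "discounted_sum c (Suc n) = c n + discounted_sum c n / 2"

lemma discounted_sum_nonneg: "(\<And>k. 0 \<le> c k) \<Longrightarrow> 0 \<le> discounted_sum c n"
  by (induction n) auto

lemma discounted_sum_le: "(\<And>k. c k \<le> L) \<Longrightarrow> 0 \<le> L \<Longrightarrow> discounted_sum c n \<le> 2 * L"
proof (induction n)
  case (Suc n)
  have "discounted_sum c n \<le> 2 * L" "c n \<le> L" using Suc by blast+
  then show ?case by simp
qed auto

lemma sum_discounted_sum_le:
  assumes "\<And>k. 0 \<le> c k"
  shows "(\<Sum>k<n. discounted_sum c k) \<le> 2 * (\<Sum>k<n. c k)"
proof -
  have "(\<Sum>k<n. discounted_sum c k) + 2 * discounted_sum c n = 2 * (\<Sum>k<n. c k)"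
    by (induction n) auto
  then show ?thesis using discounted_sum_nonneg [of c n, OF assms] by linarith
qed

text \<open>
  \<open>back_proj f n\<close>, composed with the \<open>n\<close>-th iterate of the Gauss map, is the conditional expectation
  of the orbit sum \<open>orbit_sum f n\<close> given that iterate; no conditional expectation is used, only the
  duality in \<open>integral_orbit_sum_mult\<close>.
\<close>

primrec back_proj :: "(nat \<Rightarrow> real \<Rightarrow> real) \<Rightarrow> nat \<Rightarrow> real \<Rightarrow> real" where
  "back_proj f 0 = (\<lambda>_. 0)"
| "back_proj f (Suc n) = transfer_op (\<lambda>x. f n x + back_proj f n x)"

text \<open>
  The sum of a non-stationary sequence of functions along an orbit.
\<close>

definition orbit_sum :: "(nat \<Rightarrow> real \<Rightarrow> real) \<Rightarrow> nat \<Rightarrow> real \<Rightarrow> real" where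
  "orbit_sum f n x = (\<Sum>k<n. f k ((gauss_map ^^ k) x))"

context
  fixes f :: "nat \<Rightarrow> real \<Rightarrow> real"
  assumes f: "\<And>k. bdd_meas (f k)"
begin

lemma bdd_meas_back_proj: "bdd_meas (back_proj f n)"
  by (induction n) (auto intro!: bdd_meas_transfer_op bdd_meas_add f)

lemma bdd_meas_orbit_sum: "bdd_meas (orbit_sum f n)"
  unfolding orbit_sum_def [abs_def] by (intro bdd_meas_sum bdd_meas_gauss_map_funpow f)

lemma integral_orbit_sum_mult:
  assumes "bdd_meas g"
  shows "(\<integral>x. orbit_sum f n x * g ((gauss_map ^^ n) x) \<partial>gauss_measure)
    = (\<integral>x. back_proj f n x * g x \<partial>gauss_measure)"
  using assms
proof (induction n arbitrary: g)
  case 0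
  then show ?case by (simp add: orbit_sum_def)
next
  case (Suc n)
  let ?g = "\<lambda>x. g (gauss_map x)"
  have g: "bdd_meas ?g" by (rule bdd_meas_gauss_map) fact
  note b = bdd_meas_back_proj [of n] bdd_meas_orbit_sum [of n] f [of n] g
  have "(\<integral>x. orbit_sum f (Suc n) x * g ((gauss_map ^^ Suc n) x) \<partial>gauss_measure)
    = (\<integral>x. orbit_sum f n x * ?g ((gauss_map ^^ n) x)
        + (\<lambda>x. f n x * ?g x) ((gauss_map ^^ n) x) \<partial>gauss_measure)"
    by (simp add: orbit_sum_def distrib_right)
  also have "\<dots> = (\<integral>x. orbit_sum f n x * ?g ((gauss_map ^^ n) x) \<partial>gauss_measure)
      + (\<integral>x. (\<lambda>x. f n x * ?g x) ((gauss_map ^^ n) x) \<partial>gauss_measure)"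
    by (intro Bochner_Integration.integral_add integrable_bdd_meas
        bdd_meas_mult [OF b(2) bdd_meas_gauss_map_funpow [OF g]]
        bdd_meas_gauss_map_funpow [OF bdd_meas_mult [OF b(3,4)]])
  also have "\<dots> = (\<integral>x. back_proj f n x * ?g x \<partial>gauss_measure) + (\<integral>x. f n x * ?g x \<partial>gauss_measure)"
    by (simp only: Suc.IH [OF g] integral_gauss_map_funpow [OF bdd_meas_mult [OF b(3,4)]])
  also have "\<dots> = (\<integral>x. back_proj f n x * ?g x + f n x * ?g x \<partial>gauss_measure)"
    by (intro Bochner_Integration.integral_add [symmetric] integrable_bdd_meas bdd_meas_mult b)
  also have "\<dots> = (\<integral>x. (f n x + back_proj f n x) * ?g x \<partial>gauss_measure)"
    by (simp add: algebra_simps)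
  also have "\<dots> = (\<integral>x. back_proj f (Suc n) x * g x \<partial>gauss_measure)"
    by (simp add: integral_mult_gauss_map_real [OF bdd_meas_add [OF b(3,1)] Suc.prems])
  finally show ?case .
qed

lemma integral_orbit_sum_square_Suc:
  "(\<integral>x. (orbit_sum f (Suc n) x)\<^sup>2 \<partial>gauss_measure)
    = (\<integral>x. (orbit_sum f n x)\<^sup>2 \<partial>gauss_measure)
      + 2 * (\<integral>x. back_proj f n x * f n x \<partial>gauss_measure) + (\<integral>x. (f n x)\<^sup>2 \<partial>gauss_measure)"
proof -
  let ?fn = "\<lambda>x. f n ((gauss_map ^^ n) x)"
  note b = bdd_meas_orbit_sum [of n] bdd_meas_gauss_map_funpow [OF f, of n n]
  have "(\<integral>x. (orbit_sum f (Suc n) x)\<^sup>2 \<partial>gauss_measure)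
    = (\<integral>x. (orbit_sum f n x)\<^sup>2 + (2 * (orbit_sum f n x * ?fn x) + (?fn x)\<^sup>2) \<partial>gauss_measure)"
    by (simp add: orbit_sum_def power2_sum algebra_simps)
  also have "\<dots> = (\<integral>x. (orbit_sum f n x)\<^sup>2 \<partial>gauss_measure)
      + (\<integral>x. 2 * (orbit_sum f n x * ?fn x) + (?fn x)\<^sup>2 \<partial>gauss_measure)"
    by (intro Bochner_Integration.integral_add integrable_bdd_meas bdd_meas_add bdd_meas_mult
        bdd_meas_power2 bdd_meas_const b)
  also have "(\<integral>x. 2 * (orbit_sum f n x * ?fn x) + (?fn x)\<^sup>2 \<partial>gauss_measure)
    = (\<integral>x. 2 * (orbit_sum f n x * ?fn x) \<partial>gauss_measure) + (\<integral>x. (?fn x)\<^sup>2 \<partial>gauss_measure)"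
    by (intro Bochner_Integration.integral_add integrable_bdd_meas bdd_meas_add bdd_meas_mult
        bdd_meas_power2 bdd_meas_const b)
  also have "(\<integral>x. 2 * (orbit_sum f n x * ?fn x) \<partial>gauss_measure)
      = 2 * (\<integral>x. back_proj f n x * f n x \<partial>gauss_measure)"
    by (simp add: integral_orbit_sum_mult [OF f])
  also have "(\<integral>x. (?fn x)\<^sup>2 \<partial>gauss_measure) = (\<integral>x. (f n x)\<^sup>2 \<partial>gauss_measure)"
    by (rule integral_gauss_map_funpow [OF bdd_meas_power2 [OF f]])
  finally show ?thesis by simp
qed

lemma integral_back_proj:
  assumes "\<And>k. (\<integral>x. f k x \<partial>gauss_measure) = 0"
  shows "(\<integral>x. back_proj f n x \<partial>gauss_measure) = 0"
proof (induction n)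
  case (Suc n)
  then show ?case
    using assms [of n]
    by (simp add: integral_transfer_op_real bdd_meas_add f bdd_meas_back_proj integrable_bdd_meas)
qed simp

lemma phi_lip_back_proj:
  assumes L: "\<And>k. phi_lip (c k) (transfer_op (f k))" and c: "\<And>k. 0 \<le> c k"
  shows "phi_lip (discounted_sum c n) (back_proj f n)"
proof (induction n)
  case (Suc n)
  have "phi_lip (c n + discounted_sum c n / 2) (\<lambda>x. transfer_op (f n) x + transfer_op (back_proj f n) x)"
    by (intro phi_lip_add L phi_lip_transfer_op Suc bdd_meas_back_proj discounted_sum_nonneg c)
  then show ?case
    by (auto intro: phi_lip_cong simp: transfer_op_add f bdd_meas_back_proj)
qed (simp add: phi_lip_def)

end

section \<open>The variance of sums of digit indicators\<close>

text \<open>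
  A sequence of digit sets; \<open>D k\<close> constrains the digit with (one-based) number \<open>k + 1\<close>.
\<close>

locale digit_sequence =
  fixes D :: "nat \<Rightarrow> int set"
begin

text \<open>
  Probability, variance and centred indicator of the \<open>k\<close>-th event.
\<close>

definition p :: "nat \<Rightarrow> real" where
  "p k = (\<integral>x. digit_event (D k) x \<partial>gauss_measure)"

definition q :: "nat \<Rightarrow> real" where
  "q k = p k * (1 - p k)"

definition f :: "nat \<Rightarrow> real \<Rightarrow> real" where
  "f k x = digit_event (D k) x - p k"

text \<open>
  The averages of the past (see \<^const>\<open>back_proj\<close>) and the centred sums of digit indicators.
\<close>

abbreviation "H \<equiv> back_proj f"
abbreviation "T \<equiv> orbit_sum f"

text \<open>
  Lipschitz constants for \<open>H\<close> whose total is of the order of \<open>\<Sum>k<n. q k\<close>, in contrast to the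
  uniform constant \<open>1 / 4\<close>.
\<close>

definition lam :: "nat \<Rightarrow> real" where
  "lam = discounted_sum (\<lambda>k. 6 * q k)"

text \<open>
  The variance of the centred sum.
\<close>

definition var :: "nat \<Rightarrow> real" where
  "var n = (\<integral>x. (T n x)\<^sup>2 \<partial>gauss_measure)"

text \<open>
  The conditional variance of the \<open>k\<close>-th reversed martingale increment, as a function of the point
  with number \<open>k + 1\<close> of the orbit (see \<open>transfer_op_incr_square\<close>).
\<close>

definition cond_var :: "nat \<Rightarrow> real \<Rightarrow> real" where
  "cond_var k x = transfer_op (\<lambda>y. (f k y + H k y)\<^sup>2) x - (H (Suc k) x)\<^sup>2"

lemma p_bounds: "0 \<le> p k" "p k \<le> 1"
proof -
  have "(\<integral>x. 0 \<partial>gauss_measure) \<le> p k"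
    unfolding p_def by (rule integral_irr_I_mono) (simp_all, simp add: digit_event_def)
  then show "0 \<le> p k" by simp
  have "p k \<le> (\<integral>x. 1 \<partial>gauss_measure)"
    unfolding p_def by (rule integral_irr_I_mono) (simp_all, simp add: digit_event_def indicator_def)
  then show "p k \<le> 1" by (simp add: gauss.prob_space [simplified])
qed

lemma q_nonneg: "0 \<le> q k"
  using p_bounds by (simp add: q_def)

lemma bdd_f: "bdd_meas (f k)"
  unfolding f_def [abs_def] by (intro bdd_meas_diff) simp_all

lemmas bdd_H = bdd_meas_back_proj [where f = f, OF bdd_f]
lemmas bdd_T = bdd_meas_orbit_sum [where f = f, OF bdd_f]

lemma digit_fun_f: "digit_fun (f k)"
  by (simp add: digit_fun_def f_def digit_event_inv_branch)

lemma f_abs_le_1: "\<bar>f k x\<bar> \<le> 1"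
  using p_bounds [of k] by (auto simp: f_def digit_event_def indicator_def)

lemma integral_f: "(\<integral>x. f k x \<partial>gauss_measure) = 0"
  by (simp add: f_def integrable_bdd_meas gauss.prob_space [simplified] flip: p_def)

lemma integral_digit_event_affine:
  "(\<integral>x. a * digit_event (D k) x + b \<partial>gauss_measure) = a * p k + b"
proof -
  have "(\<integral>x. a * digit_event (D k) x + b \<partial>gauss_measure)
    = (\<integral>x. a * digit_event (D k) x \<partial>gauss_measure) + (\<integral>x. b \<partial>gauss_measure)"
    by (intro Bochner_Integration.integral_add integrable_bdd_meas bdd_meas_mult) simp_all
  then show ?thesis by (simp add: gauss.prob_space [simplified] p_def)
qed

lemma integral_abs_f: "(\<integral>x. \<bar>f k x\<bar> \<partial>gauss_measure) = 2 * q k"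
proof -
  have "\<bar>f k x\<bar> = (1 - 2 * p k) * digit_event (D k) x + p k" for x
    using p_bounds [of k] by (auto simp: f_def digit_event_def indicator_def)
  then have "(\<integral>x. \<bar>f k x\<bar> \<partial>gauss_measure) = (1 - 2 * p k) * p k + p k"
    by (simp only: integral_digit_event_affine)
  then show ?thesis by (simp add: q_def algebra_simps)
qed

lemma integral_f_square: "(\<integral>x. (f k x)\<^sup>2 \<partial>gauss_measure) = q k"
proof -
  have "(f k x)\<^sup>2 = (1 - 2 * p k) * digit_event (D k) x + (p k)\<^sup>2" for x
    by (auto simp: f_def digit_event_def indicator_def power2_eq_square algebra_simps)
  then have "(\<integral>x. (f k x)\<^sup>2 \<partial>gauss_measure) = (1 - 2 * p k) * p k + (p k)\<^sup>2"
    by (simp only: integral_digit_event_affine)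
  then show ?thesis by (simp add: q_def power2_eq_square algebra_simps)
qed

lemma transfer_op_f: "x \<in> irr_I \<Longrightarrow> transfer_op (f k) x = transfer_op (digit_event (D k)) x - p k"
  unfolding f_def [abs_def] by (simp add: transfer_op_diff transfer_op_const)

lemma phi_lip_transfer_op_f: "phi_lip (1 / 8) (transfer_op (f k))"
  using phi_lip_digit_event [of "D k"] by (simp add: phi_lip_def transfer_op_f)

lemma phi_lip_transfer_op_f': "phi_lip (6 * q k) (transfer_op (f k))"
  using phi_lip_transfer_op_digit_fun [OF bdd_f digit_fun_f, of k] by (simp add: integral_abs_f)

lemma phi_lip_H: "phi_lip (1 / 4) (H n)"
proof (rule phi_lip_mono)
  show "phi_lip (discounted_sum (\<lambda>_. 1 / 8) n) (H n)"
    by (intro phi_lip_back_proj bdd_f phi_lip_transfer_op_f) simp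
  show "discounted_sum (\<lambda>_. 1 / 8) n \<le> 1 / 4"
    using discounted_sum_le [of "\<lambda>_. 1 / 8" "1 / 8" n] by simp
qed

lemma phi_lip_H': "phi_lip (lam n) (H n)"
  unfolding lam_def by (intro phi_lip_back_proj bdd_f phi_lip_transfer_op_f') (simp add: q_nonneg)

lemma lam_nonneg: "0 \<le> lam n"
  unfolding lam_def by (intro discounted_sum_nonneg) (simp add: q_nonneg)

lemma sum_lam_le: "(\<Sum>k<n. lam k) \<le> 12 * (\<Sum>k<n. q k)"
  using sum_discounted_sum_le [of "\<lambda>k. 6 * q k" n] q_nonneg
  by (simp add: lam_def sum_distrib_left [symmetric])

lemma H_abs_le: "x \<in> irr_I \<Longrightarrow> \<bar>H n x\<bar> \<le> 3 / 8"
  using phi_lip_mean_zero_bound [OF bdd_H phi_lip_H _ integral_back_proj [where f = f, OF bdd_f integral_f], of x n] by simp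

lemma H_abs_le_lam: "x \<in> irr_I \<Longrightarrow> \<bar>H n x\<bar> \<le> 3 / 2 * lam n"
  by (rule phi_lip_mean_zero_bound [OF bdd_H phi_lip_H' lam_nonneg integral_back_proj [where f = f, OF bdd_f integral_f]])

lemma var_Suc: "var (Suc n) = var n + 2 * (\<integral>x. H n x * f n x \<partial>gauss_measure) + q n"
  using integral_orbit_sum_square_Suc [where f = f, OF bdd_f, of n] by (simp add: var_def integral_f_square)

text \<open>
  The variance is at least a quarter of the sum of the single variances: the correlations with the
  past can cancel at most three quarters of each new term.
\<close>

lemma var_lower: "(\<Sum>k<n. q k) \<le> 4 * var n"
proof (induction n)
  case 0
  then show ?case by (simp add: var_def)
next
  case (Suc n)
  have "\<bar>\<integral>x. H n x * f n x \<partial>gauss_measure\<bar> \<le> 3 / 8 * q n"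
    using integral_centred_mult_bound [OF bdd_H [of n] phi_lip_H [of n] _ bdd_f [of n] integral_f [of n]]
    by (simp add: integral_abs_f)
  then show ?case using Suc by (simp add: var_Suc)
qed

lemma bdd_u2: "bdd_meas (\<lambda>y. (f k y + H k y)\<^sup>2)"
  by (intro bdd_meas_power2 bdd_meas_add bdd_f bdd_H)

lemma bdd_cond_var: "bdd_meas (cond_var k)"
  unfolding cond_var_def [abs_def]
  by (intro bdd_meas_diff bdd_meas_transfer_op bdd_meas_power2 bdd_u2 bdd_H)

text \<open>
  The reversed martingale increments, before composition with the iterate of the Gauss map.
\<close>

definition incr :: "nat \<Rightarrow> real \<Rightarrow> real" where
  "incr k x = f k x + H k x - H (Suc k) (gauss_map x)"

lemma bdd_incr: "bdd_meas (incr k)"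
  unfolding incr_def [abs_def]
  by (intro bdd_meas_diff bdd_meas_add bdd_meas_gauss_map [OF bdd_H] bdd_f bdd_H)

lemma incr_abs_le: "x \<in> irr_I \<Longrightarrow> \<bar>incr k x\<bar> \<le> 2"
  using f_abs_le_1 [of k x] H_abs_le [of x k] H_abs_le [OF gauss_map_irr_I, of x "Suc k"]
  unfolding incr_def by linarith

lemma transfer_op_incr:
  assumes x: "x \<in> irr_I" shows "transfer_op (incr k) x = 0"
proof -
  have "transfer_op (incr k) x
      = transfer_op (\<lambda>y. f k y + H k y) x - transfer_op (\<lambda>y. H (Suc k) (gauss_map y)) x"
    unfolding incr_def [abs_def]
    by (intro transfer_op_diff bdd_meas_add bdd_meas_gauss_map [OF bdd_H] bdd_f bdd_H x)
  also have "\<dots> = 0" using x by (simp only: transfer_op_comp_gauss_map) simp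
  finally show ?thesis .
qed

lemma transfer_op_incr_square:
  assumes x: "x \<in> irr_I" shows "transfer_op (\<lambda>y. (incr k y)\<^sup>2) x = cond_var k x"
proof -
  let ?u = "\<lambda>y. f k y + H k y"
  let ?h = "H (Suc k)"
  have u: "bdd_meas ?u" by (intro bdd_meas_add bdd_f bdd_H)
  have hG: "bdd_meas (\<lambda>y. ?h (gauss_map y))" by (rule bdd_meas_gauss_map [OF bdd_H])
  have h2: "bdd_meas (\<lambda>y. (?h y)\<^sup>2)" by (rule bdd_meas_power2 [OF bdd_H])
  have uh: "bdd_meas (\<lambda>y. ?u y * ?h (gauss_map y))" by (rule bdd_meas_mult [OF u hG])
  have uh2: "bdd_meas (\<lambda>y. 2 * (?u y * ?h (gauss_map y)))" by (rule bdd_meas_mult [OF bdd_meas_const uh])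
  have hG2: "bdd_meas (\<lambda>y. (?h (gauss_map y))\<^sup>2)" by (rule bdd_meas_power2 [OF hG])
  have "(\<lambda>y. (incr k y)\<^sup>2)
    = (\<lambda>y. (?u y)\<^sup>2 - (2 * (?u y * ?h (gauss_map y)) - (?h (gauss_map y))\<^sup>2))"
    by (simp add: incr_def fun_eq_iff power2_eq_square algebra_simps del: back_proj.simps)
  then have "transfer_op (\<lambda>y. (incr k y)\<^sup>2) x = transfer_op (\<lambda>y. (?u y)\<^sup>2) x
      - (transfer_op (\<lambda>y. 2 * (?u y * ?h (gauss_map y))) x - transfer_op (\<lambda>y. (?h (gauss_map y))\<^sup>2) x)"
    by (simp only: transfer_op_diff [OF bdd_u2 bdd_meas_diff [OF uh2 hG2] x] transfer_op_diff [OF uh2 hG2 x])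
  moreover have "transfer_op (\<lambda>y. (?h (gauss_map y))\<^sup>2) x = (?h x)\<^sup>2"
    using transfer_op_comp_gauss_map [OF x, of "\<lambda>y. (?h y)\<^sup>2"] .
  moreover have "transfer_op (\<lambda>y. 2 * (?u y * ?h (gauss_map y))) x = 2 * (?h x * ?h x)"
    using transfer_op_mult_left [OF uh x, of 2] transfer_op_mult_gauss_map [OF u x, of ?h] by simp
  ultimately show ?thesis unfolding cond_var_def by (simp only: power2_eq_square)
qed

lemma cond_var_nonneg: "x \<in> irr_I \<Longrightarrow> 0 \<le> cond_var k x"
  using transfer_op_mono [OF bdd_meas_const bdd_meas_power2 [OF bdd_incr], of x 0 k]
  by (simp add: transfer_op_const transfer_op_incr_square)

lemma cond_var_le_4: "x \<in> irr_I \<Longrightarrow> cond_var k x \<le> 4"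
  using transfer_op_mono [OF bdd_meas_power2 [OF bdd_incr] bdd_meas_const, of x k 4] incr_abs_le
    power_mono [of "\<bar>incr k _\<bar>" 2 2]
  by (simp add: transfer_op_const transfer_op_incr_square)

text \<open>
  A pointwise bound by quantities whose total is of the order of the variance; bounded distortion
  enters through \<open>transfer_op_digit_fun_le\<close>.
\<close>

lemma cond_var_le: 
  assumes x: "x \<in> irr_I"
  shows "cond_var k x \<le> 6 * q k + 2 * lam k"
proof -
  have f2: "bdd_meas (\<lambda>y. (f k y)\<^sup>2)" by (rule bdd_meas_power2 [OF bdd_f])
  have "cond_var k x \<le> transfer_op (\<lambda>y. (f k y + H k y)\<^sup>2) x" by (simp add: cond_var_def)
  also have "\<dots> \<le> transfer_op (\<lambda>y. 2 * (f k y)\<^sup>2 + 2 * lam k) x"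
  proof (rule transfer_op_mono [OF bdd_u2 _ x])
    show "bdd_meas (\<lambda>y. 2 * (f k y)\<^sup>2 + 2 * lam k)"
      by (intro bdd_meas_add bdd_meas_mult f2 bdd_meas_const)
    fix y assume y: "y \<in> irr_I"
    \<comment> \<open>one factor is bounded uniformly, the other by the constant that is small with \<open>q\<close>\<close>
    have "(H k y)\<^sup>2 = \<bar>H k y\<bar> * \<bar>H k y\<bar>" by (simp add: power2_eq_square)
    also have "\<dots> \<le> 3 / 8 * (3 / 2 * lam k)"
      using lam_nonneg by (intro mult_mono H_abs_le H_abs_le_lam y) auto
    finally have "(H k y)\<^sup>2 \<le> lam k" using lam_nonneg [of k] by simp
    moreover have "(f k y + H k y)\<^sup>2 + (f k y - H k y)\<^sup>2 = 2 * (f k y)\<^sup>2 + 2 * (H k y)\<^sup>2"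
      by (simp add: power2_eq_square algebra_simps)
    ultimately show "(f k y + H k y)\<^sup>2 \<le> 2 * (f k y)\<^sup>2 + 2 * lam k"
      using zero_le_power2 [of "f k y - H k y"] by linarith
  qed
  also have "\<dots> = 2 * transfer_op (\<lambda>y. (f k y)\<^sup>2) x + 2 * lam k"
    using x f2 by (simp add: transfer_op_add transfer_op_const transfer_op_mult_left bdd_meas_mult)
  also have "transfer_op (\<lambda>y. (f k y)\<^sup>2) x \<le> 3 * q k"
    using transfer_op_digit_fun_le [OF f2 digit_fun_comp [OF digit_fun_f, where g = power2] _ x]
    by (simp add: integral_f_square)
  finally show ?thesis by simp
qed

lemma sum_cond_var_bound: "(\<Sum>k<n. 6 * q k + 2 * lam k) \<le> 120 * var n"
proof -
  have "(\<Sum>k<n. 6 * q k + 2 * lam k) = 6 * (\<Sum>k<n. q k) + 2 * (\<Sum>k<n. lam k)"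
    by (simp add: sum.distrib sum_distrib_left)
  also have "\<dots> \<le> 120 * var n" using sum_lam_le [of n] var_lower [of n] by linarith
  finally show ?thesis .
qed

lemma sum_integral_cond_var:
  "(\<Sum>k<n. \<integral>x. cond_var k x \<partial>gauss_measure) = var n - (\<integral>x. (H n x)\<^sup>2 \<partial>gauss_measure)"
proof (induction n)
  case 0
  then show ?case by (simp add: var_def orbit_sum_def)
next
  case (Suc n)
  have "(\<integral>x. cond_var n x \<partial>gauss_measure)
    = (\<integral>x. transfer_op (\<lambda>y. (f n y + H n y)\<^sup>2) x \<partial>gauss_measure) - (\<integral>x. (H (Suc n) x)\<^sup>2 \<partial>gauss_measure)"
    unfolding cond_var_def
    by (intro Bochner_Integration.integral_diff integrable_bdd_meas bdd_meas_transfer_op bdd_u2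
        bdd_meas_power2 bdd_H)
  also have "(\<integral>x. transfer_op (\<lambda>y. (f n y + H n y)\<^sup>2) x \<partial>gauss_measure)
      = (\<integral>x. (f n x)\<^sup>2 + (2 * (H n x * f n x) + (H n x)\<^sup>2) \<partial>gauss_measure)"
    by (subst integral_transfer_op_real [OF bdd_u2]) (simp add: power2_sum mult_ac add_ac)
  also have "\<dots> = (\<integral>x. (f n x)\<^sup>2 \<partial>gauss_measure) + (\<integral>x. 2 * (H n x * f n x) + (H n x)\<^sup>2 \<partial>gauss_measure)"
    by (intro Bochner_Integration.integral_add integrable_bdd_meas bdd_meas_add bdd_meas_mult
        bdd_meas_power2 bdd_H bdd_f bdd_meas_const)
  also have "(\<integral>x. 2 * (H n x * f n x) + (H n x)\<^sup>2 \<partial>gauss_measure)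
    = (\<integral>x. 2 * (H n x * f n x) \<partial>gauss_measure) + (\<integral>x. (H n x)\<^sup>2 \<partial>gauss_measure)"
    by (intro Bochner_Integration.integral_add integrable_bdd_meas bdd_meas_add bdd_meas_mult
        bdd_meas_power2 bdd_H bdd_f bdd_meas_const)
  finally show ?case using Suc by (simp add: var_Suc integral_f_square del: back_proj.simps)
qed

end

section \<open>Concentration of the conditional variances\<close>

lemma abs_phi_diff_le: "x \<in> irr_I \<Longrightarrow> y \<in> irr_I \<Longrightarrow> \<bar>phi x - phi y\<bar> \<le> 2 * \<bar>x - y\<bar>"
proof -
  assume "x \<in> irr_I" "y \<in> irr_I"
  then have pos: "0 < x" "0 < y" by (auto simp: irr_I_def)
  have "1 / ((1 + y) * (1 + x)) \<le> 1 / (1 * 1)"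
    using pos by (intro divide_left_mono mult_mono) auto
  then have "\<bar>1 + 1 / ((1 + y) * (1 + x))\<bar> \<le> 2" using pos by (simp add: abs_of_pos add_pos_pos)
  then show ?thesis
    using mult_left_mono [of "\<bar>1 + 1 / ((1 + y) * (1 + x))\<bar>" 2 "\<bar>x - y\<bar>"]
    by (simp add: phi_diff_eq [OF pos(2,1)] abs_mult mult.commute)
qed

lemma inv_branch_contract: "x \<in> irr_I \<Longrightarrow> y \<in> irr_I \<Longrightarrow> \<bar>inv_branch i x - inv_branch i y\<bar> \<le> \<bar>x - y\<bar>"
proof -
  assume "x \<in> irr_I" "y \<in> irr_I"
  then have pos: "0 < x" "0 < y" by (auto simp: irr_I_def)
  define a b where "a = x + real i + 1" and "b = y + real i + 1"
  have ab: "a \<ge> 1" "b \<ge> 1" using pos by (auto simp: a_def b_def)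
  have "1 / a - 1 / b = (b - a) / (a * b)" using ab by (simp add: field_simps)
  then have "\<bar>1 / a - 1 / b\<bar> = \<bar>b - a\<bar> / (a * b)" using ab by (simp add: abs_mult)
  also have "\<dots> \<le> \<bar>b - a\<bar> / (1 * 1)"
    using ab by (intro divide_left_mono mult_mono) auto
  finally show ?thesis by (simp add: inv_branch_def a_def b_def abs_minus_commute)
qed

lemma phi_lip_abs:
  assumes "phi_lip L f" "x \<in> irr_I" "y \<in> irr_I"
  shows "\<bar>f x - f y\<bar> \<le> L * \<bar>phi x - phi y\<bar>"
proof (cases "x \<le> y")
  case True
  then show ?thesis using phi_lipD [OF assms True] phi_mono [OF assms(2) True] by simp
next
  case False
  then show ?thesis using phi_lipD [OF assms(1,3,2)] phi_mono [of y x] assms(3)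
    by (simp add: abs_minus_commute)
qed

context digit_sequence
begin

declare back_proj.simps(2) [simp del]

lemma phi_lip_H_square: "phi_lip 1 (\<lambda>x. (H n x)\<^sup>2)"
proof (rule phi_lipI)
  fix x y assume x: "x \<in> irr_I" and y: "y \<in> irr_I" and xy: "x \<le> y"
  have "\<bar>(H n x)\<^sup>2 - (H n y)\<^sup>2\<bar> = \<bar>H n x + H n y\<bar> * \<bar>H n x - H n y\<bar>"
    by (simp add: power2_eq_square square_diff_square_factored abs_mult)
  also have "\<dots> \<le> 1 * (1 / 4 * (phi y - phi x))"
    using H_abs_le [OF x, of n] H_abs_le [OF y, of n] phi_lipD [OF phi_lip_H x y xy, of n]
    by (intro mult_mono) linarith+
  also have "\<dots> \<le> 1 * (phi y - phi x)" using phi_mono [OF x xy] by simp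
  finally show "\<bar>(H n x)\<^sup>2 - (H n y)\<^sup>2\<bar> \<le> 1 * (phi y - phi x)" .
qed

lemma phi_lip_cond_var: "phi_lip 7 (cond_var k)"
proof (rule phi_lipI)
  fix x y assume x: "x \<in> irr_I" and y: "y \<in> irr_I" and xy: "x \<le> y"
  let ?u = "\<lambda>y. f k y + H k y"
  have u_le: "\<bar>?u z\<bar> \<le> 2" if "z \<in> irr_I" for z
    using f_abs_le_1 [of k z] H_abs_le [OF that, of k] by linarith
  have "\<bar>transfer_op (\<lambda>y. (?u y)\<^sup>2) x - transfer_op (\<lambda>y. (?u y)\<^sup>2) y\<bar>
      \<le> \<bar>x - y\<bar> * transfer_op (\<lambda>z. \<bar>(?u z)\<^sup>2\<bar>) x + 2 * \<bar>x - y\<bar>"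
  proof (rule transfer_op_diff_bound [OF bdd_u2 x y])
    fix i
    let ?a = "inv_branch i x" and ?b = "inv_branch i y"
    have ab: "?a \<in> irr_I" "?b \<in> irr_I" using x y by (auto intro: inv_branch_irr_I)
    \<comment> \<open>both points lie in the same branch, so the digit part of \<open>?u\<close> cancels\<close>
    have "\<bar>(?u ?a)\<^sup>2 - (?u ?b)\<^sup>2\<bar> = \<bar>?u ?a + ?u ?b\<bar> * \<bar>H k ?a - H k ?b\<bar>"
      using digit_funD [OF digit_fun_f x y, of k i]
      by (simp add: power2_eq_square square_diff_square_factored abs_mult)
    also have "\<dots> \<le> 4 * (1 / 4 * (2 * \<bar>x - y\<bar>))"
    proof (intro mult_mono)
      show "\<bar>?u ?a + ?u ?b\<bar> \<le> 4" using u_le [OF ab(1)] u_le [OF ab(2)] by linarith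
      have "\<bar>H k ?a - H k ?b\<bar> \<le> 1 / 4 * \<bar>phi ?a - phi ?b\<bar>" by (rule phi_lip_abs [OF phi_lip_H ab])
      also have "\<bar>phi ?a - phi ?b\<bar> \<le> 2 * \<bar>?a - ?b\<bar>" by (rule abs_phi_diff_le [OF ab])
      also have "\<bar>?a - ?b\<bar> \<le> \<bar>x - y\<bar>" by (rule inv_branch_contract [OF x y])
      finally show "\<bar>H k ?a - H k ?b\<bar> \<le> 1 / 4 * (2 * \<bar>x - y\<bar>)" by simp
    qed auto
    finally show "\<bar>(?u ?a)\<^sup>2 - (?u ?b)\<^sup>2\<bar> \<le> 2 * \<bar>x - y\<bar>" by simp
  qed
  also have "\<dots> \<le> \<bar>x - y\<bar> * 4 + 2 * \<bar>x - y\<bar>"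
  proof -
    have "transfer_op (\<lambda>z. \<bar>(?u z)\<^sup>2\<bar>) x \<le> transfer_op (\<lambda>_. 4) x"
      using abs_le_square_iff [of "?u _" 2] u_le
      by (intro transfer_op_mono [OF bdd_meas_abs [OF bdd_u2] bdd_meas_const x]) auto
    then show ?thesis
      using x by (intro add_right_mono mult_left_mono) (simp_all add: transfer_op_const)
  qed
  also have "\<dots> = 6 * (y - x)" using xy by simp
  also have "\<dots> \<le> 6 * (phi y - phi x)" using diff_le_phi_diff [OF irr_I_pos [OF x] xy] by simp
  finally have 1: "\<bar>transfer_op (\<lambda>y. (?u y)\<^sup>2) x - transfer_op (\<lambda>y. (?u y)\<^sup>2) y\<bar> \<le> 6 * (phi y - phi x)" .
  have 2: "\<bar>(H (Suc k) x)\<^sup>2 - (H (Suc k) y)\<^sup>2\<bar> \<le> 1 * (phi y - phi x)"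
    by (rule phi_lipD [OF phi_lip_H_square x y xy])
  show "\<bar>cond_var k x - cond_var k y\<bar> \<le> 7 * (phi y - phi x)"
    unfolding cond_var_def using 1 2 by linarith
qed

text \<open>
  The mean of the conditional variance.
\<close>

definition mean_cond_var :: "nat \<Rightarrow> real" where
  "mean_cond_var k = (\<integral>x. cond_var k x \<partial>gauss_measure)"

lemma mean_cond_var_bounds: "0 \<le> mean_cond_var k" "mean_cond_var k \<le> 4"
proof -
  have "(\<integral>x. 0 \<partial>gauss_measure) \<le> mean_cond_var k"
    unfolding mean_cond_var_def
    by (rule integral_irr_I_mono [OF bdd_meas_const bdd_cond_var]) (rule cond_var_nonneg)
  then show "0 \<le> mean_cond_var k" by simp
  have "mean_cond_var k \<le> (\<integral>x. 4 \<partial>gauss_measure)"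
    unfolding mean_cond_var_def
    by (rule integral_irr_I_mono [OF bdd_cond_var bdd_meas_const]) (rule cond_var_le_4)
  then show "mean_cond_var k \<le> 4" by (simp add: gauss.prob_space [simplified])
qed

text \<open>
  The deviation of the conditional variance from its mean.
\<close>

definition dev :: "nat \<Rightarrow> real \<Rightarrow> real" where
  "dev k x = cond_var k x - mean_cond_var k"

lemma bdd_dev: "bdd_meas (dev k)"
  unfolding dev_def [abs_def] by (intro bdd_meas_diff bdd_cond_var bdd_meas_const)

lemma integral_dev: "(\<integral>x. dev k x \<partial>gauss_measure) = 0"
  by (simp add: dev_def integrable_bdd_meas bdd_cond_var gauss.prob_space [simplified]
      flip: mean_cond_var_def)

lemma integral_abs_dev: "(\<integral>x. \<bar>dev k x\<bar> \<partial>gauss_measure) \<le> 2 * mean_cond_var k"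
proof -
  have "(\<integral>x. \<bar>dev k x\<bar> \<partial>gauss_measure) \<le> (\<integral>x. cond_var k x + mean_cond_var k \<partial>gauss_measure)"
  proof (rule integral_irr_I_mono)
    show "\<bar>dev k x\<bar> \<le> cond_var k x + mean_cond_var k" if "x \<in> irr_I" for x
      using cond_var_nonneg [OF that, of k] mean_cond_var_bounds [of k] by (simp add: dev_def)
  qed (intro bdd_meas_abs bdd_dev bdd_meas_add bdd_cond_var bdd_meas_const)+
  then show ?thesis
    by (simp add: integrable_bdd_meas bdd_cond_var gauss.prob_space [simplified] flip: mean_cond_var_def)
qed

lemma integral_dev_square: "(\<integral>x. (dev k x)\<^sup>2 \<partial>gauss_measure) \<le> 8 * mean_cond_var k"
proof -
  have "(\<integral>x. (dev k x)\<^sup>2 \<partial>gauss_measure) \<le> (\<integral>x. 4 * \<bar>dev k x\<bar> \<partial>gauss_measure)"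
  proof (rule integral_irr_I_mono)
    fix x assume x: "x \<in> irr_I"
    have "\<bar>dev k x\<bar> \<le> 4"
      using cond_var_nonneg [OF x, of k] cond_var_le_4 [OF x, of k] mean_cond_var_bounds [of k]
      by (simp add: dev_def)
    then have "\<bar>dev k x\<bar> * \<bar>dev k x\<bar> \<le> 4 * \<bar>dev k x\<bar>" by (intro mult_right_mono) auto
    then show "(dev k x)\<^sup>2 \<le> 4 * \<bar>dev k x\<bar>" by (simp add: power2_eq_square)
  qed (intro bdd_meas_abs bdd_dev bdd_meas_mult bdd_meas_power2 bdd_meas_const)+
  then show ?thesis using integral_abs_dev [of k] by simp
qed

lemma phi_lip_dev: "phi_lip 7 (dev k)"
  using phi_lip_cond_var [of k] by (simp add: phi_lip_def dev_def)

lemma phi_lip_back_proj_dev: "phi_lip 7 (back_proj dev n)"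
proof (rule phi_lip_mono)
  show "phi_lip (discounted_sum (\<lambda>_. 7 / 2) n) (back_proj dev n)"
    by (intro phi_lip_back_proj bdd_dev phi_lip_transfer_op phi_lip_dev) simp_all
  show "discounted_sum (\<lambda>_. 7 / 2) n \<le> 7"
    using discounted_sum_le [of "\<lambda>_. 7 / 2" "7 / 2" n] by simp
qed

lemma integral_orbit_sum_dev_square:
  "(\<integral>x. (orbit_sum dev n x)\<^sup>2 \<partial>gauss_measure) \<le> 29 * (\<Sum>k<n. mean_cond_var k)"
proof (induction n)
  case 0
  then show ?case by (simp add: orbit_sum_def)
next
  case (Suc n)
  have "\<bar>\<integral>x. back_proj dev n x * dev n x \<partial>gauss_measure\<bar>
      \<le> 3 / 4 * 7 * (\<integral>x. \<bar>dev n x\<bar> \<partial>gauss_measure)"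
    by (rule integral_centred_mult_bound [OF bdd_meas_back_proj [where f = dev, OF bdd_dev] phi_lip_back_proj_dev _
          bdd_dev integral_dev]) simp
  then show ?case
    using Suc integral_abs_dev [of n] integral_dev_square [of n]
    by (simp add: integral_orbit_sum_square_Suc [where f = dev, OF bdd_dev])
qed

text \<open>
  The sum of the conditional variances along the orbit; it starts at the image of \<open>x\<close> because
  the \<open>k\<close>-th increment is conditioned on the \<open>(k + 1)\<close>-st iterate.
\<close>

definition Q :: "nat \<Rightarrow> real \<Rightarrow> real" where
  "Q n x = orbit_sum cond_var n (gauss_map x)"

lemma bdd_Q: "bdd_meas (Q n)"
  unfolding Q_def [abs_def] by (intro bdd_meas_gauss_map bdd_meas_orbit_sum bdd_cond_var)

lemma sum_mean_cond_var: "(\<Sum>k<n. mean_cond_var k) = var n - (\<integral>x. (H n x)\<^sup>2 \<partial>gauss_measure)"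
  using sum_integral_cond_var by (simp add: mean_cond_var_def)

lemma integral_H_square: "0 \<le> (\<integral>x. (H n x)\<^sup>2 \<partial>gauss_measure)" "(\<integral>x. (H n x)\<^sup>2 \<partial>gauss_measure) \<le> 1"
proof -
  show "0 \<le> (\<integral>x. (H n x)\<^sup>2 \<partial>gauss_measure)" by simp
  have "(\<integral>x. (H n x)\<^sup>2 \<partial>gauss_measure) \<le> (\<integral>x. 1 \<partial>gauss_measure)"
  proof (rule integral_irr_I_mono [OF bdd_meas_power2 [OF bdd_H] bdd_meas_const])
    show "(H n x)\<^sup>2 \<le> 1" if "x \<in> irr_I" for x
      using H_abs_le [OF that, of n] abs_le_square_iff [of "H n x" 1] by simp
  qed
  then show "(\<integral>x. (H n x)\<^sup>2 \<partial>gauss_measure) \<le> 1" by (simp add: gauss.prob_space [simplified])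
qed

text \<open>
  The sum of the conditional variances is close to the variance in mean: the square of its deviation
  from its own mean integrates to at most \<open>29 * var n\<close>, by the same recursion as for the variance itself.
\<close>

lemma integral_abs_Q_diff:
  assumes "var n > 0"
  shows "(\<integral>x. \<bar>Q n x - var n\<bar> \<partial>gauss_measure) \<le> 15 * sqrt (var n) + 1"
proof -
  define s where "s = sqrt (var n)"
  have s: "s > 0" "s\<^sup>2 = var n" using assms by (auto simp: s_def)
  let ?m = "\<Sum>k<n. mean_cond_var k"
  let ?d = "orbit_sum dev n"
  have bd: "bdd_meas ?d" by (rule bdd_meas_orbit_sum [where f = dev, OF bdd_dev])
  have "(\<integral>x. \<bar>Q n x - var n\<bar> \<partial>gauss_measure) = (\<integral>x. (\<lambda>y. \<bar>?d y + (?m - var n)\<bar>) ((gauss_map ^^ 1) x) \<partial>gauss_measure)"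
    by (simp add: Q_def orbit_sum_def dev_def sum_subtractf)
  also have "\<dots> = (\<integral>x. \<bar>?d x + (?m - var n)\<bar> \<partial>gauss_measure)"
    by (intro integral_gauss_map_funpow bdd_meas_abs bdd_meas_add bd bdd_meas_const)
  also have "\<dots> \<le> (\<integral>x. (1 / (2 * s)) * (?d x)\<^sup>2 + (s / 2 + 1) \<partial>gauss_measure)"
  proof (rule integral_irr_I_mono)
    fix x
    \<comment> \<open>the elementary inequality replaces the Cauchy-Schwarz inequality\<close>
    have "\<bar>?d x\<bar> \<le> (1 / (2 * s)) * (?d x)\<^sup>2 + s / 2"
      using s zero_le_power2 [of "\<bar>?d x\<bar> - s"] by (simp add: power2_diff field_simps power2_eq_square)
    moreover have "\<bar>?m - var n\<bar> \<le> 1"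
      using integral_H_square [of n] by (simp add: sum_mean_cond_var)
    ultimately show "\<bar>?d x + (?m - var n)\<bar> \<le> (1 / (2 * s)) * (?d x)\<^sup>2 + (s / 2 + 1)"
      by linarith
  qed (intro bdd_meas_abs bdd_meas_add bdd_meas_mult bdd_meas_power2 bd bdd_meas_const)+
  also have "\<dots> = (1 / (2 * s)) * (\<integral>x. (?d x)\<^sup>2 \<partial>gauss_measure) + (s / 2 + 1)"
    by (simp add: integrable_bdd_meas bdd_meas_power2 bd gauss.prob_space [simplified])
  also have "\<dots> \<le> (1 / (2 * s)) * (29 * var n) + (s / 2 + 1)"
  proof -
    have "(\<integral>x. (?d x)\<^sup>2 \<partial>gauss_measure) \<le> 29 * var n"
      using integral_orbit_sum_dev_square [of n]
    proof (rule order_trans)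
      show "29 * (\<Sum>k<n. mean_cond_var k) \<le> 29 * var n"
        using integral_H_square(1) [of n] by (simp add: sum_mean_cond_var)
    qed
    then show ?thesis using s by (intro add_right_mono mult_left_mono) auto
  qed
  also have "\<dots> = 15 * s + 1" using s by (simp add: power2_eq_square flip: s(2))
  finally show ?thesis by (simp add: s_def)
qed

end

section \<open>The characteristic function\<close>

lemma exp_quadratic_compensation:
  fixes a :: real
  assumes "0 \<le> a"
  shows "\<bar>(1 - a) * exp a - 1\<bar> \<le> a\<^sup>2 * exp a"
proof -
  have "1 - a \<le> exp (- a)" using exp_ge_add_one_self [of "- a"] by simp
  then have 1: "(1 - a) * exp a \<le> 1"
    using mult_right_mono [of "1 - a" "exp (- a)" "exp a"] by (simp add: exp_minus)
  have "exp (- a) = 1 / exp a" by (simp add: exp_minus divide_inverse)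
  also have "\<dots> \<le> 1 / (1 + a)"
    using assms exp_ge_add_one_self [of a] by (intro divide_left_mono mult_pos_pos) auto
  also have "\<dots> \<le> 1 - a + a\<^sup>2"
  proof -
    have "(1 - a + a\<^sup>2) * (1 + a) = 1 + a ^ 3"
      by (simp add: algebra_simps power2_eq_square power3_eq_cube)
    then show ?thesis using assms by (simp add: pos_divide_le_eq)
  qed
  finally have "exp (- a) * exp a \<le> (1 - a + a\<^sup>2) * exp a" by (intro mult_right_mono) auto
  then have "1 \<le> (1 - a) * exp a + a\<^sup>2 * exp a" by (simp add: exp_minus distrib_right)
  with 1 show ?thesis by simp
qed

lemma exp_diff_le:
  fixes a b :: real
  assumes "a \<le> c" "b \<le> c"
  shows "\<bar>exp a - exp b\<bar> \<le> exp c * \<bar>a - b\<bar>"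
proof -
  have *: "exp b - exp a \<le> exp c * (b - a)" if "a \<le> b" "b \<le> c" for a b :: real
  proof -
    have "exp b * (1 + (a - b)) \<le> exp b * exp (a - b)"
      by (intro mult_left_mono exp_ge_add_one_self) auto
    then have "exp b - exp a \<le> exp b * (b - a)" by (simp add: exp_diff algebra_simps)
    also have "\<dots> \<le> exp c * (b - a)" using that by (intro mult_right_mono) auto
    finally show ?thesis .
  qed
  show ?thesis using *[of a b] *[of b a] assms by (cases "a \<le> b") auto
qed

lemma iexp_second_order: "cmod (iexp y - (1 + \<i> * of_real y - of_real (y\<^sup>2 / 2))) \<le> \<bar>y\<bar> ^ 3 / 6"
proof -
  have "(\<Sum>k\<le>2. (\<i> * complex_of_real y) ^ k / fact k) = 1 + \<i> * of_real y - of_real (y\<^sup>2 / 2)"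
    by (simp add: numeral_2_eq_2 power_mult_distrib)
  then show ?thesis using iexp_approx1 [of y 2] by (simp add: eval_nat_numeral fact_numeral)
qed

lemma cmod_iexp_diff_le: "cmod (iexp a - iexp b) \<le> \<bar>a - b\<bar>"
proof -
  have "iexp a - iexp b = iexp b * (iexp (a - b) - 1)"
    by (simp add: right_diff_distrib flip: exp_add)
  also have "cmod \<dots> = cmod (iexp (a - b) - 1)" by (simp add: norm_mult)
  also have "\<dots> \<le> \<bar>a - b\<bar>" using iexp_approx1 [of "a - b" 0] by simp
  finally show ?thesis .
qed

lemma bdd_meas_iexp:
  assumes "bdd_meas f" shows "bdd_meas (\<lambda>x. iexp (f x))"
proof (rule bdd_measI [where B = 1])
  have [measurable]: "f \<in> borel_measurable borel" using assms by (rule bdd_measD)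
  show "(\<lambda>x. iexp (f x)) \<in> borel_measurable borel" by measurable
qed simp

lemma bdd_meas_exp:
  assumes "bdd_meas f" shows "bdd_meas (\<lambda>x. exp (f x :: real))"
proof -
  obtain B where B: "\<And>x. x \<in> irr_I \<Longrightarrow> norm (f x) \<le> B" using bdd_measE [OF assms] by metis
  show ?thesis
  proof (rule bdd_measI [where B = "exp B"])
    have [measurable]: "f \<in> borel_measurable borel" using assms by (rule bdd_measD)
    show "(\<lambda>x. exp (f x)) \<in> borel_measurable borel" by measurable
    show "norm (exp (f x)) \<le> exp B" if "x \<in> irr_I" for x using B [OF that] by simp
  qed
qed

context digit_sequence
begin

text \<open>
  One factor of the compensated exponential, and the product of \<open>m\<close> consecutive factors starting
  with number \<open>k\<close>, seen from the \<open>k\<close>-th point of the orbit.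
\<close>

definition step :: "real \<Rightarrow> nat \<Rightarrow> real \<Rightarrow> complex" where
  "step \<theta> k x = iexp (\<theta> * incr k x) * of_real (exp (\<theta>\<^sup>2 / 2 * cond_var k (gauss_map x)))"

definition steps :: "real \<Rightarrow> nat \<Rightarrow> nat \<Rightarrow> real \<Rightarrow> complex" where
  "steps \<theta> k m x = (\<Prod>j<m. step \<theta> (k + j) ((gauss_map ^^ j) x))"

lemma bdd_compensator: "bdd_meas (\<lambda>x. exp (\<theta>\<^sup>2 / 2 * cond_var k x))"
  by (intro bdd_meas_exp bdd_meas_mult bdd_cond_var bdd_meas_const)

lemma bdd_iexp_incr: "bdd_meas (\<lambda>x. iexp (\<theta> * incr k x))"
  by (intro bdd_meas_iexp bdd_meas_mult bdd_incr bdd_meas_const)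

lemma bdd_step: "bdd_meas (step \<theta> k)"
  unfolding step_def [abs_def]
  by (rule bdd_meas_mult [OF bdd_iexp_incr bdd_meas_of_real [OF bdd_meas_gauss_map [OF bdd_compensator]]])

lemma steps_0: "steps \<theta> k 0 x = 1"
  by (simp add: steps_def)

lemma steps_Suc: "steps \<theta> k (Suc m) x = step \<theta> k x * steps \<theta> (Suc k) m (gauss_map x)"
  unfolding steps_def prod.lessThan_Suc_shift
  by (simp add: funpow_swap1)

lemma bdd_steps: "bdd_meas (steps \<theta> k m)"
proof (induction m arbitrary: k)
  case 0
  then show ?case by (simp add: steps_def)
next
  case (Suc m)
  then show ?case
    unfolding steps_Suc by (intro bdd_meas_mult [OF bdd_step] bdd_meas_gauss_map)
qed

text \<open>
  Averaged over the preimages of a point, a factor equals \<open>1\<close> up to third order: the first moment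
  of the increment vanishes, and the compensator cancels its second moment.
\<close>

lemma transfer_op_step_bound:
  assumes x: "x \<in> irr_I" and \<theta>: "\<bar>\<theta>\<bar> \<le> 1"
  shows "cmod (transfer_op (step \<theta> k) x - 1) \<le> 2 * exp 2 * \<bar>\<theta>\<bar> ^ 3 * cond_var k x"
proof -
  define c where "c = cond_var k x"
  define a where "a = \<theta>\<^sup>2 / 2 * c"
  define e where "e = (\<lambda>y. iexp (\<theta> * incr k y))"
  have c: "0 \<le> c" "c \<le> 4" using cond_var_nonneg [OF x] cond_var_le_4 [OF x] by (auto simp: c_def)
  have \<theta>2: "\<theta>\<^sup>2 \<le> 1" using \<theta> abs_le_square_iff [of \<theta> 1] by simp
  have a0: "0 \<le> a" using c by (simp add: a_def)
  have "\<theta>\<^sup>2 * c \<le> 1 * 4" using \<theta>2 c by (intro mult_mono) auto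
  then have a2: "a \<le> 2" by (simp add: a_def)
  have be: "bdd_meas e" unfolding e_def by (rule bdd_iexp_incr)
  have bi: "bdd_meas (\<lambda>y. complex_of_real (incr k y))" by (rule bdd_meas_of_real [OF bdd_incr])
  have bi2: "bdd_meas (\<lambda>y. complex_of_real ((incr k y)\<^sup>2))"
    by (rule bdd_meas_of_real [OF bdd_meas_power2 [OF bdd_incr]])
  have blin: "bdd_meas (\<lambda>y. 1 + (\<i> * \<theta>) * complex_of_real (incr k y))"
    by (intro bdd_meas_add bdd_meas_mult [OF bdd_meas_const bi] bdd_meas_const)
  have bquad: "bdd_meas (\<lambda>y. complex_of_real (\<theta>\<^sup>2 / 2) * complex_of_real ((incr k y)\<^sup>2))"
    by (rule bdd_meas_mult [OF bdd_meas_const bi2])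
  let ?taylor = "\<lambda>y. 1 + (\<i> * \<theta>) * complex_of_real (incr k y)
      - complex_of_real (\<theta>\<^sup>2 / 2) * complex_of_real ((incr k y)\<^sup>2)"
  have btay: "bdd_meas ?taylor" by (rule bdd_meas_diff [OF blin bquad])
  have Ptay: "transfer_op ?taylor x = of_real (1 - a)"
  proof -
    have "transfer_op ?taylor x = transfer_op (\<lambda>y. 1 + (\<i> * \<theta>) * complex_of_real (incr k y)) x
        - transfer_op (\<lambda>y. complex_of_real (\<theta>\<^sup>2 / 2) * complex_of_real ((incr k y)\<^sup>2)) x"
      by (rule transfer_op_diff [OF blin bquad x])
    moreover have "transfer_op (\<lambda>y. 1 + (\<i> * \<theta>) * complex_of_real (incr k y)) x = 1"
      using transfer_op_add [OF bdd_meas_const bdd_meas_mult [OF bdd_meas_const bi] x, of 1 "\<i> * \<theta>"]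
        transfer_op_mult_left [OF bi x, of "\<i> * \<theta>"] transfer_op_of_real [OF bdd_incr x, of k] x
      by (simp add: transfer_op_const transfer_op_incr)
    moreover have "transfer_op (\<lambda>y. complex_of_real (\<theta>\<^sup>2 / 2) * complex_of_real ((incr k y)\<^sup>2)) x = of_real a"
      using transfer_op_mult_left [OF bi2 x, of "complex_of_real (\<theta>\<^sup>2 / 2)"]
        transfer_op_of_real [OF bdd_meas_power2 [OF bdd_incr] x, of k]
        transfer_op_incr_square [OF x, of k]
      by (simp add: a_def c_def)
    ultimately show ?thesis by simp
  qed
  have "cmod (transfer_op e x - of_real (1 - a)) = cmod (transfer_op (\<lambda>y. e y - ?taylor y) x)"
    using transfer_op_diff [OF be btay x] Ptay by simp
  also have "\<dots> \<le> transfer_op (\<lambda>y. cmod (e y - ?taylor y)) x"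
    by (rule transfer_op_norm_le [OF bdd_meas_diff [OF be btay] x])
  also have "\<dots> \<le> transfer_op (\<lambda>y. \<bar>\<theta>\<bar> ^ 3 / 3 * (incr k y)\<^sup>2) x"
  proof (rule transfer_op_mono [OF bdd_meas_norm [OF bdd_meas_diff [OF be btay]] _ x])
    show "bdd_meas (\<lambda>y. \<bar>\<theta>\<bar> ^ 3 / 3 * (incr k y)\<^sup>2)"
      by (rule bdd_meas_mult [OF bdd_meas_const bdd_meas_power2 [OF bdd_incr]])
    fix y assume y: "y \<in> irr_I"
    have eq: "?taylor y = 1 + \<i> * of_real (\<theta> * incr k y) - of_real ((\<theta> * incr k y)\<^sup>2 / 2)"
      by (simp add: power_mult_distrib mult.assoc)
    have "cmod (e y - ?taylor y) \<le> \<bar>\<theta> * incr k y\<bar> ^ 3 / 6"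
      unfolding eq e_def by (rule iexp_second_order)
    also have "\<dots> = \<bar>\<theta>\<bar> ^ 3 / 6 * (incr k y)\<^sup>2 * \<bar>incr k y\<bar>"
    proof -
      have "\<bar>incr k y\<bar> ^ 3 = (incr k y)\<^sup>2 * \<bar>incr k y\<bar>"
        by (simp add: power3_eq_cube power2_eq_square)
      then show ?thesis by (simp add: abs_mult power_mult_distrib)
    qed
    also have "\<dots> \<le> \<bar>\<theta>\<bar> ^ 3 / 6 * (incr k y)\<^sup>2 * 2"
      by (intro mult_left_mono incr_abs_le y) auto
    finally show "cmod (e y - ?taylor y) \<le> \<bar>\<theta>\<bar> ^ 3 / 3 * (incr k y)\<^sup>2" by simp
  qed
  also have "\<dots> = \<bar>\<theta>\<bar> ^ 3 / 3 * c"
    by (simp only: transfer_op_mult_left [OF bdd_meas_power2 [OF bdd_incr] x] transfer_op_incr_square [OF x] c_def)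
  finally have E: "cmod (transfer_op e x - of_real (1 - a)) \<le> \<bar>\<theta>\<bar> ^ 3 / 3 * c" .
  have "transfer_op (step \<theta> k) x = transfer_op e x * of_real (exp a)"
    unfolding step_def [abs_def] a_def c_def e_def
    using transfer_op_mult_gauss_map [OF bdd_iexp_incr x, where g = "\<lambda>x. of_real (exp (\<theta>\<^sup>2 / 2 * cond_var k x))"]
    by simp
  then have "transfer_op (step \<theta> k) x - 1
      = (transfer_op e x - of_real (1 - a)) * of_real (exp a) + of_real ((1 - a) * exp a - 1)"
    by (simp add: algebra_simps)
  also have "cmod \<dots> \<le> cmod ((transfer_op e x - of_real (1 - a)) * of_real (exp a))
      + cmod (of_real ((1 - a) * exp a - 1))"
    by (rule norm_triangle_ineq)
  also have "\<dots> \<le> \<bar>\<theta>\<bar> ^ 3 / 3 * c * exp a + a\<^sup>2 * exp a"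
    unfolding norm_mult norm_of_real
    using E c exp_quadratic_compensation [OF a0] by (intro add_mono mult_mono) auto
  also have "\<dots> \<le> \<bar>\<theta>\<bar> ^ 3 / 3 * c * exp a + \<bar>\<theta>\<bar> ^ 3 * c * exp a"
  proof (intro add_left_mono mult_right_mono)
    show "0 \<le> exp a" by simp
    show "a\<^sup>2 \<le> \<bar>\<theta>\<bar> ^ 3 * c"
    proof -
      have "a\<^sup>2 = \<theta>\<^sup>2 * \<theta>\<^sup>2 / 4 * (c * c)" by (simp add: a_def power2_eq_square)
      also have "\<dots> \<le> \<bar>\<theta>\<bar> ^ 3 / 4 * (c * 4)"
      proof (intro mult_mono divide_right_mono)
        have "\<bar>\<theta>\<bar> ^ 4 \<le> \<bar>\<theta>\<bar> ^ 3" using \<theta> by (intro power_decreasing) auto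
        then show "\<theta>\<^sup>2 * \<theta>\<^sup>2 \<le> \<bar>\<theta>\<bar> ^ 3" by (simp add: power4_eq_xxxx power2_eq_square)
      qed (use c in auto)
      finally show ?thesis by simp
    qed
  qed
  also have "\<dots> = (\<bar>\<theta>\<bar> ^ 3 / 3 * c + \<bar>\<theta>\<bar> ^ 3 * c) * exp a"
    by (simp only: distrib_right)
  finally have "cmod (transfer_op (step \<theta> k) x - 1) \<le> (\<bar>\<theta>\<bar> ^ 3 / 3 * c + \<bar>\<theta>\<bar> ^ 3 * c) * exp a" .
  also have "\<dots> \<le> (\<bar>\<theta>\<bar> ^ 3 / 3 * c + \<bar>\<theta>\<bar> ^ 3 * c) * exp 2"
    using a2 c by (intro mult_left_mono) auto
  also have "\<dots> \<le> (2 * (\<bar>\<theta>\<bar> ^ 3 * c)) * exp 2"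
    using c by (intro mult_right_mono) auto
  finally show ?thesis by (simp add: c_def mult_ac)
qed

text \<open>
  The pointwise bound of the conditional variances from \<open>cond_var_le\<close>.
\<close>

definition cv_bound :: "nat \<Rightarrow> real" where
  "cv_bound k = 6 * q k + 2 * lam k"

lemma cv_bound_nonneg: "0 \<le> cv_bound k"
  using q_nonneg lam_nonneg by (simp add: cv_bound_def)

lemma sum_cv_bound_le:
  assumes "k + m \<le> n" shows "(\<Sum>j<m. cv_bound (k + j)) \<le> 120 * var n"
proof -
  have "(\<Sum>j<m. cv_bound (k + j)) = sum cv_bound ((+) k ` {..<m})"
    by (simp add: sum.reindex)
  also have "\<dots> \<le> sum cv_bound {..<n}"
    using assms by (intro sum_mono2) (auto simp: cv_bound_nonneg)
  also have "\<dots> \<le> 120 * var n" unfolding cv_bound_def by (rule sum_cond_var_bound)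
  finally show ?thesis .
qed

lemma cmod_steps_le:
  assumes x: "x \<in> irr_I" and n: "k + m \<le> n"
  shows "cmod (steps \<theta> k m x) \<le> exp (60 * \<theta>\<^sup>2 * var n)"
proof -
  have "cmod (steps \<theta> k m x) = (\<Prod>j<m. exp (\<theta>\<^sup>2 / 2 * cond_var (k + j) (gauss_map ((gauss_map ^^ j) x))))"
    by (simp add: steps_def step_def norm_mult flip: prod_norm)
  also have "\<dots> \<le> (\<Prod>j<m. exp (\<theta>\<^sup>2 / 2 * cv_bound (k + j)))"
    unfolding cv_bound_def
    by (intro prod_mono conjI) (auto intro!: mult_left_mono cond_var_le gauss_map_irr_I gauss_map_funpow_irr_I x)
  also have "\<dots> = exp (\<theta>\<^sup>2 / 2 * (\<Sum>j<m. cv_bound (k + j)))"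
    by (simp add: exp_sum sum_distrib_left)
  also have "\<dots> \<le> exp (\<theta>\<^sup>2 / 2 * (120 * var n))"
    using mult_left_mono [OF sum_cv_bound_le [OF n], of "\<theta>\<^sup>2 / 2"] by simp
  finally show ?thesis by (simp add: mult_ac)
qed

text \<open>
  Removing the factors one by one, the earliest first: by duality the integral of the product changes
  by the integral of \<open>(P (step \<theta> k) - 1) * steps \<theta> (k + 1) m\<close>, with \<open>P\<close> the transfer operator.
\<close>

lemma integral_steps_bound:
  assumes \<theta>: "\<bar>\<theta>\<bar> \<le> 1"
  shows "k + m \<le> n \<Longrightarrow> cmod ((\<integral>x. steps \<theta> k m x \<partial>gauss_measure) - 1)
    \<le> (\<Sum>j<m. cv_bound (k + j)) * (2 * exp 2 * \<bar>\<theta>\<bar> ^ 3 * exp (60 * \<theta>\<^sup>2 * var n))"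
proof (induction m arbitrary: k)
  case 0
  then show ?case by (simp add: steps_0 gauss.prob_space [simplified])
next
  case (Suc m)
  define C where "C = 2 * exp 2 * \<bar>\<theta>\<bar> ^ 3 * exp (60 * \<theta>\<^sup>2 * var n)"
  let ?w = "steps \<theta> (Suc k) m"
  have bP: "bdd_meas (transfer_op (step \<theta> k))" by (rule bdd_meas_transfer_op [OF bdd_step])
  have bd: "bdd_meas (\<lambda>x. (transfer_op (step \<theta> k) x - 1) * ?w x)"
    by (intro bdd_meas_mult bdd_meas_diff bP bdd_meas_const bdd_steps)
  have int: "integrable gauss_measure (\<lambda>x. transfer_op (step \<theta> k) x * ?w x)" "integrable gauss_measure ?w"
    by (intro integrable_bdd_meas bdd_meas_mult bP bdd_steps)+
  have "(\<integral>x. steps \<theta> k (Suc m) x \<partial>gauss_measure) = (\<integral>x. transfer_op (step \<theta> k) x * ?w x \<partial>gauss_measure)"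
    unfolding steps_Suc by (rule integral_mult_gauss_map_complex [OF bdd_step bdd_steps])
  then have "(\<integral>x. steps \<theta> k (Suc m) x \<partial>gauss_measure) - (\<integral>x. ?w x \<partial>gauss_measure)
      = (\<integral>x. (transfer_op (step \<theta> k) x - 1) * ?w x \<partial>gauss_measure)"
    using int by (simp add: left_diff_distrib)
  also have "cmod \<dots> \<le> (\<integral>x. cmod ((transfer_op (step \<theta> k) x - 1) * ?w x) \<partial>gauss_measure)"
    by (rule integral_norm_bound)
  also have "\<dots> \<le> (\<integral>x. cv_bound k * C \<partial>gauss_measure)"
  proof (rule integral_irr_I_mono [OF bdd_meas_norm [OF bd] bdd_meas_const])
    fix x assume x: "x \<in> irr_I"
    have "cmod (transfer_op (step \<theta> k) x - 1) \<le> 2 * exp 2 * \<bar>\<theta>\<bar> ^ 3 * cond_var k x"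
      by (rule transfer_op_step_bound [OF x \<theta>])
    also have "\<dots> \<le> 2 * exp 2 * \<bar>\<theta>\<bar> ^ 3 * cv_bound k"
      unfolding cv_bound_def by (intro mult_left_mono cond_var_le x) auto
    finally have "cmod ((transfer_op (step \<theta> k) x - 1) * ?w x)
        \<le> (2 * exp 2 * \<bar>\<theta>\<bar> ^ 3 * cv_bound k) * exp (60 * \<theta>\<^sup>2 * var n)"
      unfolding norm_mult using Suc.prems
      by (intro mult_mono cmod_steps_le x) (auto simp: cv_bound_nonneg)
    then show "cmod ((transfer_op (step \<theta> k) x - 1) * ?w x) \<le> cv_bound k * C"
      by (simp add: C_def mult_ac)
  qed
  also have "\<dots> = cv_bound k * C" by (simp add: gauss.prob_space [simplified])
  finally have "cmod ((\<integral>x. steps \<theta> k (Suc m) x \<partial>gauss_measure) - (\<integral>x. ?w x \<partial>gauss_measure)) \<le> cv_bound k * C" .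
  moreover have "cmod ((\<integral>x. ?w x \<partial>gauss_measure) - 1) \<le> (\<Sum>j<m. cv_bound (Suc k + j)) * C"
    unfolding C_def using Suc.prems by (intro Suc.IH) simp
  ultimately have "cmod ((\<integral>x. steps \<theta> k (Suc m) x \<partial>gauss_measure) - 1)
      \<le> cv_bound k * C + (\<Sum>j<m. cv_bound (Suc k + j)) * C"
    using norm_triangle_ineq [of "(\<integral>x. steps \<theta> k (Suc m) x \<partial>gauss_measure) - (\<integral>x. ?w x \<partial>gauss_measure)"
        "(\<integral>x. ?w x \<partial>gauss_measure) - 1"] by simp
  also have "\<dots> = (\<Sum>j<Suc m. cv_bound (k + j)) * C"
    unfolding sum.lessThan_Suc_shift by (simp add: distrib_right)
  finally show ?case by (simp add: C_def)
qed

text \<open>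
  The reversed martingale approximating the centred sum.
\<close>

definition mart :: "nat \<Rightarrow> real \<Rightarrow> real" where
  "mart n x = (\<Sum>k<n. incr k ((gauss_map ^^ k) x))"

lemma orbit_sum_eq_mart: "T n x = mart n x + H n ((gauss_map ^^ n) x)"
  by (induction n) (auto simp: orbit_sum_def mart_def incr_def)

lemma steps_eq: "steps \<theta> 0 n x = iexp (\<theta> * mart n x) * of_real (exp (\<theta>\<^sup>2 / 2 * Q n x))"
proof -
  have "steps \<theta> 0 n x = (\<Prod>j<n. iexp (\<theta> * incr j ((gauss_map ^^ j) x)))
     * of_real (\<Prod>j<n. exp (\<theta>\<^sup>2 / 2 * cond_var j ((gauss_map ^^ j) (gauss_map x))))"
    by (simp add: steps_def step_def prod.distrib funpow_swap1)
  also have "(\<Prod>j<n. iexp (\<theta> * incr j ((gauss_map ^^ j) x))) = iexp (\<theta> * mart n x)"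
    by (simp add: mart_def exp_sum [symmetric] sum_distrib_left)
  also have "(\<Prod>j<n. exp (\<theta>\<^sup>2 / 2 * cond_var j ((gauss_map ^^ j) (gauss_map x)))) = exp (\<theta>\<^sup>2 / 2 * Q n x)"
    by (simp add: Q_def orbit_sum_def exp_sum [symmetric] sum_distrib_left)
  finally show ?thesis .
qed

lemma Q_le: "x \<in> irr_I \<Longrightarrow> Q n x \<le> 120 * var n"
proof -
  assume x: "x \<in> irr_I"
  have "Q n x \<le> (\<Sum>k<n. cv_bound (0 + k))"
    unfolding Q_def orbit_sum_def cv_bound_def add_0
    by (intro sum_mono cond_var_le gauss_map_funpow_irr_I gauss_map_irr_I x)
  also have "\<dots> \<le> 120 * var n" by (rule sum_cv_bound_le) simp
  finally show ?thesis .
qed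

theorem char_bound:
  assumes s: "s = sqrt (var n)" "s \<ge> 1" and t: "\<bar>t\<bar> \<le> s"
  shows "cmod ((\<integral>x. iexp (t / s * T n x) \<partial>gauss_measure) * exp (t\<^sup>2 / 2) - 1)
    \<le> (240 * exp 2 * \<bar>t\<bar> ^ 3 * exp (60 * t\<^sup>2) + exp (t\<^sup>2 / 2) * \<bar>t\<bar> + 8 * exp (60 * t\<^sup>2) * t\<^sup>2) / s"
proof -
  define \<theta> where "\<theta> = t / s"
  define A where "A = exp (60 * t\<^sup>2)"
  have s2: "var n = s\<^sup>2" and vpos: "var n > 0"
  proof -
    have "var n > 0" using s by (metis not_le order_trans real_sqrt_le_0_iff zero_less_one less_le_trans)
    then show "var n > 0" "var n = s\<^sup>2" using s by auto
  qed
  have \<theta>: "\<bar>\<theta>\<bar> \<le> 1" using t s by (simp add: \<theta>_def)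
  have \<theta>v: "\<theta>\<^sup>2 * var n = t\<^sup>2" using s by (simp add: \<theta>_def s2 power_divide)
  let ?X = "\<lambda>x. iexp (\<theta> * T n x) * of_real (exp (t\<^sup>2 / 2))"
  have bX: "bdd_meas ?X"
    by (intro bdd_meas_mult bdd_meas_iexp bdd_meas_const bdd_T)
  have bS: "bdd_meas (steps \<theta> 0 n)" by (rule bdd_steps)
  have step1: "cmod ((\<integral>x. steps \<theta> 0 n x \<partial>gauss_measure) - 1) \<le> 240 * exp 2 * \<bar>t\<bar> ^ 3 * A / s"
  proof -
    have "cmod ((\<integral>x. steps \<theta> 0 n x \<partial>gauss_measure) - 1)
        \<le> (\<Sum>j<n. cv_bound (0 + j)) * (2 * exp 2 * \<bar>\<theta>\<bar> ^ 3 * exp (60 * \<theta>\<^sup>2 * var n))"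
      by (rule integral_steps_bound [OF \<theta>]) simp
    also have "\<dots> \<le> (120 * var n) * (2 * exp 2 * \<bar>\<theta>\<bar> ^ 3 * exp (60 * \<theta>\<^sup>2 * var n))"
      by (intro mult_right_mono sum_cv_bound_le) auto
    also have "\<dots> = (120 * s\<^sup>2) * (2 * exp 2 * (\<bar>t\<bar> ^ 3 / s ^ 3) * A)"
      using s by (simp add: A_def mult.assoc \<theta>v s2 flip: s2) (simp add: \<theta>_def power_divide s2)
    also have "\<dots> = 240 * exp 2 * \<bar>t\<bar> ^ 3 * A / s"
      using s by (simp add: power2_eq_square power3_eq_cube)
    finally show ?thesis .
  qed
  have step2: "cmod ((\<integral>x. ?X x \<partial>gauss_measure) - (\<integral>x. steps \<theta> 0 n x \<partial>gauss_measure))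
      \<le> exp (t\<^sup>2 / 2) * \<bar>t\<bar> / s + 8 * A * t\<^sup>2 / s"
  proof -
    have "(\<integral>x. ?X x \<partial>gauss_measure) - (\<integral>x. steps \<theta> 0 n x \<partial>gauss_measure)
        = (\<integral>x. ?X x - steps \<theta> 0 n x \<partial>gauss_measure)"
      by (intro Bochner_Integration.integral_diff [symmetric] integrable_bdd_meas bX bS)
    also have "cmod \<dots> \<le> (\<integral>x. cmod (?X x - steps \<theta> 0 n x) \<partial>gauss_measure)"
      by (rule integral_norm_bound)
    also have "\<dots> \<le> (\<integral>x. A * (\<theta>\<^sup>2 / 2) * \<bar>Q n x - var n\<bar> + exp (t\<^sup>2 / 2) * \<bar>\<theta>\<bar> \<partial>gauss_measure)"
    proof (rule integral_irr_I_mono)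
      fix x assume x: "x \<in> irr_I"
      have "?X x - steps \<theta> 0 n x = (iexp (\<theta> * T n x) - iexp (\<theta> * mart n x)) * of_real (exp (t\<^sup>2 / 2))
          + iexp (\<theta> * mart n x) * of_real (exp (t\<^sup>2 / 2) - exp (\<theta>\<^sup>2 / 2 * Q n x))"
        by (simp add: steps_eq algebra_simps)
      also have "cmod \<dots> \<le> cmod ((iexp (\<theta> * T n x) - iexp (\<theta> * mart n x)) * of_real (exp (t\<^sup>2 / 2)))
          + cmod (iexp (\<theta> * mart n x) * of_real (exp (t\<^sup>2 / 2) - exp (\<theta>\<^sup>2 / 2 * Q n x)))"
        by (rule norm_triangle_ineq)
      also have "cmod ((iexp (\<theta> * T n x) - iexp (\<theta> * mart n x)) * of_real (exp (t\<^sup>2 / 2)))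
          \<le> \<bar>\<theta>\<bar> * exp (t\<^sup>2 / 2)"
      proof -
        have "cmod (iexp (\<theta> * T n x) - iexp (\<theta> * mart n x)) \<le> \<bar>\<theta> * T n x - \<theta> * mart n x\<bar>"
          by (rule cmod_iexp_diff_le)
        also have "\<dots> = \<bar>\<theta>\<bar> * \<bar>H n ((gauss_map ^^ n) x)\<bar>"
          by (simp add: orbit_sum_eq_mart abs_mult flip: right_diff_distrib)
        also have "\<dots> \<le> \<bar>\<theta>\<bar> * 1"
          using H_abs_le [OF gauss_map_funpow_irr_I [OF x], of n n] by (intro mult_left_mono) auto
        finally show ?thesis by (simp add: norm_mult)
      qed
      also have "cmod (iexp (\<theta> * mart n x) * of_real (exp (t\<^sup>2 / 2) - exp (\<theta>\<^sup>2 / 2 * Q n x)))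
          \<le> A * (\<theta>\<^sup>2 / 2 * \<bar>Q n x - var n\<bar>)"
      proof -
        have "cmod (iexp (\<theta> * mart n x) * of_real (exp (t\<^sup>2 / 2) - exp (\<theta>\<^sup>2 / 2 * Q n x)))
            = \<bar>exp (t\<^sup>2 / 2) - exp (\<theta>\<^sup>2 / 2 * Q n x)\<bar>"
          unfolding norm_mult norm_of_real by simp
        also have "\<dots> \<le> exp (60 * t\<^sup>2) * \<bar>t\<^sup>2 / 2 - \<theta>\<^sup>2 / 2 * Q n x\<bar>"
        proof (rule exp_diff_le)
          have "\<theta>\<^sup>2 / 2 * Q n x \<le> \<theta>\<^sup>2 / 2 * (120 * var n)"
            by (intro mult_left_mono Q_le x) auto
          also have "\<dots> = 60 * (\<theta>\<^sup>2 * var n)" by simp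
          finally show "\<theta>\<^sup>2 / 2 * Q n x \<le> 60 * t\<^sup>2" by (simp only: \<theta>v)
        qed simp
        also have "\<bar>t\<^sup>2 / 2 - \<theta>\<^sup>2 / 2 * Q n x\<bar> = \<bar>\<theta>\<^sup>2 / 2 * (var n - Q n x)\<bar>"
          using \<theta>v by (simp add: right_diff_distrib)
        also have "\<dots> = \<theta>\<^sup>2 / 2 * \<bar>Q n x - var n\<bar>"
          by (simp add: abs_mult abs_minus_commute)
        finally show ?thesis by (simp add: A_def)
      qed
      finally show "cmod (?X x - steps \<theta> 0 n x)
          \<le> A * (\<theta>\<^sup>2 / 2) * \<bar>Q n x - var n\<bar> + exp (t\<^sup>2 / 2) * \<bar>\<theta>\<bar>"
        by (simp add: mult_ac)
    qed (intro bdd_meas_norm bdd_meas_diff bX bS bdd_meas_add bdd_meas_mult bdd_meas_abs bdd_Q bdd_meas_const)+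
    also have "\<dots> = A * (\<theta>\<^sup>2 / 2) * (\<integral>x. \<bar>Q n x - var n\<bar> \<partial>gauss_measure) + exp (t\<^sup>2 / 2) * \<bar>\<theta>\<bar>"
    proof -
      have "integrable gauss_measure (\<lambda>x. \<bar>Q n x - var n\<bar>)"
        by (intro integrable_bdd_meas bdd_meas_abs bdd_meas_diff bdd_Q bdd_meas_const)
      then show ?thesis by (simp add: gauss.prob_space [simplified])
    qed
    also have "\<dots> \<le> A * (\<theta>\<^sup>2 / 2) * (16 * s) + exp (t\<^sup>2 / 2) * \<bar>\<theta>\<bar>"
    proof -
      have "(\<integral>x. \<bar>Q n x - var n\<bar> \<partial>gauss_measure) \<le> 16 * s"
        using integral_abs_Q_diff [OF vpos] s(2) unfolding s(1) [symmetric] by linarith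
      then show ?thesis by (intro add_right_mono mult_left_mono) (auto simp: A_def)
    qed
    also have "\<dots> = exp (t\<^sup>2 / 2) * \<bar>t\<bar> / s + 8 * A * t\<^sup>2 / s"
      using s(2) by (simp add: \<theta>_def power_divide power2_eq_square)
    finally show ?thesis .
  qed
  have "(\<integral>x. iexp (t / s * T n x) \<partial>gauss_measure) * exp (t\<^sup>2 / 2) = (\<integral>x. ?X x \<partial>gauss_measure)"
    by (simp add: \<theta>_def exp_of_real)
  then have "cmod ((\<integral>x. iexp (t / s * T n x) \<partial>gauss_measure) * exp (t\<^sup>2 / 2) - 1)
      \<le> cmod ((\<integral>x. ?X x \<partial>gauss_measure) - (\<integral>x. steps \<theta> 0 n x \<partial>gauss_measure))
        + cmod ((\<integral>x. steps \<theta> 0 n x \<partial>gauss_measure) - 1)"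
    using norm_triangle_ineq [of "(\<integral>x. ?X x \<partial>gauss_measure) - (\<integral>x. steps \<theta> 0 n x \<partial>gauss_measure)"
        "(\<integral>x. steps \<theta> 0 n x \<partial>gauss_measure) - 1"] by simp
  also have "\<dots> \<le> (exp (t\<^sup>2 / 2) * \<bar>t\<bar> / s + 8 * A * t\<^sup>2 / s) + 240 * exp 2 * \<bar>t\<bar> ^ 3 * A / s"
    by (intro add_mono step1 step2)
  also have "\<dots> = (240 * exp 2 * \<bar>t\<bar> ^ 3 * A + exp (t\<^sup>2 / 2) * \<bar>t\<bar> + 8 * A * t\<^sup>2) / s"
    by (simp add: add_divide_distrib)
  finally show ?thesis by (simp add: A_def)
qed

end

section \<open>The central limit theorem\<close>

context digit_sequence
begin

text \<open>
  The standardised sum; it is \<open>0\<close> when the variance vanishes.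
\<close>

definition normalized_sum :: "nat \<Rightarrow> real \<Rightarrow> real" where
  "normalized_sum n x = T n x / sqrt (var n)"

lemma bdd_normalized_sum: "bdd_meas (normalized_sum n)"
  unfolding normalized_sum_def [abs_def] divide_inverse
  by (intro bdd_meas_mult bdd_T bdd_meas_const)

lemma weak_conv_normalized_sum:
  assumes V: "filterlim (\<lambda>n. \<Sum>k<n. q k) at_top sequentially"
  shows "weak_conv_m (\<lambda>n. distr gauss_measure borel (normalized_sum n)) std_normal_distribution"
proof (rule levy_continuity)
  have rv: "gauss.random_variable borel (normalized_sum n)" for n
    by (intro measurable_gauss_measureI bdd_measD bdd_normalized_sum)
  show "real_distribution (distr gauss_measure borel (normalized_sum n))" for n
    by (rule gauss.real_distribution_distr [OF rv])
  show "real_distribution std_normal_distribution" by (rule real_dist_normal_dist)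
  fix t :: real
  define s where "s n = sqrt (var n)" for n
  define K where "K = 240 * exp 2 * \<bar>t\<bar> ^ 3 * exp (60 * t\<^sup>2) + exp (t\<^sup>2 / 2) * \<bar>t\<bar> + 8 * exp (60 * t\<^sup>2) * t\<^sup>2"
  let ?c = "\<lambda>n. char (distr gauss_measure borel (normalized_sum n)) t"
  have "filterlim (\<lambda>n. 4 * var n) at_top sequentially"
    by (rule filterlim_at_top_mono [OF V]) (simp add: var_lower)
  from filterlim_tendsto_pos_mult_at_top [OF tendsto_const [of "1 / 4"] _ this]
  have "filterlim var at_top sequentially" by simp
  then have s_top: "filterlim s at_top sequentially"
    unfolding s_def [abs_def] by (rule filterlim_compose [OF sqrt_at_top])
  have c_eq: "?c n = (\<integral>x. iexp (t / s n * T n x) \<partial>gauss_measure)" for n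
    unfolding char_def
    by (subst integral_distr [OF rv]) (simp_all add: normalized_sum_def s_def)
  have "\<forall>\<^sub>F n in sequentially. max 1 \<bar>t\<bar> \<le> s n"
    using s_top unfolding filterlim_at_top by (rule spec)
  then have "\<forall>\<^sub>F n in sequentially. norm (?c n * exp (t\<^sup>2 / 2) - 1) \<le> K * inverse (s n)"
  proof eventually_elim
    case (elim n)
    then show ?case
      using char_bound [of "s n" n t] unfolding c_eq K_def divide_inverse by (simp add: s_def)
  qed
  moreover have "(\<lambda>n. K * inverse (s n)) \<longlonglongrightarrow> 0"
    by (intro tendsto_mult_right_zero tendsto_inverse_0_at_top s_top)
  ultimately have "(\<lambda>n. ?c n * exp (t\<^sup>2 / 2) - 1) \<longlonglongrightarrow> 0"
    by (rule Lim_null_comparison)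
  then have "(\<lambda>n. ?c n * exp (t\<^sup>2 / 2)) \<longlonglongrightarrow> 1"
    by (simp add: LIM_zero_iff)
  then have "(\<lambda>n. (?c n * exp (t\<^sup>2 / 2)) * exp (- (t\<^sup>2) / 2)) \<longlonglongrightarrow> 1 * of_real (exp (- (t\<^sup>2) / 2))"
    by (intro tendsto_mult) (auto simp: exp_of_real)
  moreover have "(?c n * exp (t\<^sup>2 / 2)) * exp (- (t\<^sup>2) / 2) = ?c n" for n
    by (simp add: mult.assoc flip: of_real_mult exp_add)
  ultimately have "?c \<longlonglongrightarrow> 1 * of_real (exp (- (t\<^sup>2) / 2))" by (simp only:)
  then show "?c \<longlonglongrightarrow> char std_normal_distribution t"
    by (simp add: char_std_normal_distribution)
qed

end

lemma measure_std_normal_lessThan: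
  "measure std_normal_distribution {..<z} = 1 / sqrt (2 * pi) * (LBINT t:{..z}. exp (- (t\<^sup>2) / 2))"
proof -
  interpret N: real_distribution std_normal_distribution by (rule real_dist_normal_dist)
  have "measure std_normal_distribution {..<z} = (\<integral>x. indicator {..<z} x \<partial>std_normal_distribution)"
    by simp
  also have "\<dots> = (\<integral>x. std_normal_density x *\<^sub>R indicator {..<z} x \<partial>lborel)"
    by (rule integral_density) auto
  also have "\<dots> = (\<integral>x. (1 / sqrt (2 * pi)) * (indicator {..z} x *\<^sub>R exp (- (x\<^sup>2) / 2)) \<partial>lborel)"
    by (intro integral_cong_AE AE_mp [OF AE_lborel_singleton [of z] AE_I2])
      (auto simp: std_normal_density_def indicator_def)
  also have "\<dots> = 1 / sqrt (2 * pi) * (LBINT t:{..z}. exp (- (t\<^sup>2) / 2))"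
    unfolding set_lebesgue_integral_def by (rule integral_mult_right_zero)
  finally show ?thesis .
qed

theorem theorem1p3:
  fixes A :: "nat \<Rightarrow> real set"
    and V :: "nat \<Rightarrow> real"
    and S :: "nat \<Rightarrow> real \<Rightarrow> real"
    and z :: real
  defines "V \<equiv> \<lambda>n. \<Sum>k=1..n. measure gauss_measure (A k) * measure gauss_measure (unit_I - A k)"
    and "S \<equiv> \<lambda>n \<omega>. \<Sum>k=1..n. indicator (A k) \<omega>"
  assumes "\<And>n. n \<ge> 1 \<Longrightarrow> A n \<in> sets (digit_algebra n)"
    and "filterlim V at_top sequentially"
  shows "(\<lambda>n. measure gauss_measure
            {\<omega> \<in> unit_I.
               (S n \<omega> - prob_space.expectation gauss_measure (S n)) /
               sqrt (prob_space.variance gauss_measure (S n)) < z})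
         \<longlonglongrightarrow> 1 / sqrt (2 * pi) * (LBINT t:{..z}. exp (- (t\<^sup>2) / 2))"
proof -
  \<comment> \<open>the events are numbered from one, the digit sets from zero\<close>
  have "\<exists>D. A (Suc k) = cf_digit (Suc k) -` D \<inter> unit_I" for k
    using assms(3) [of "Suc k"] by (auto simp: digit_algebra_def sets_vimage_algebra2)
  then obtain D where D: "\<And>k. A (Suc k) = cf_digit (Suc k) -` D k \<inter> unit_I" by metis
  interpret digit_sequence D .
  have ind: "indicator (A (Suc k)) x = digit_event (D k) ((gauss_map ^^ k) x)" if "x \<in> unit_I" for k x
    using that by (simp add: D cf_digit_def digit_event_def indicator_def)
  have A_sets: "A (Suc k) \<in> sets gauss_measure" for k
    using assms(3) [of "Suc k"] sets_digit_algebra_subset by auto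
  have A_prob: "measure gauss_measure (A (Suc k)) = p k" for k
  proof -
    have "measure gauss_measure (A (Suc k)) = (\<integral>x. indicator (A (Suc k)) x \<partial>gauss_measure)"
      using A_sets by (simp add: sets.sets_into_space D Int_commute)
    also have "\<dots> = (\<integral>x. digit_event (D k) ((gauss_map ^^ k) x) \<partial>gauss_measure)"
      by (intro Bochner_Integration.integral_cong) (auto simp: ind)
    also have "\<dots> = p k" unfolding p_def by (rule integral_gauss_map_funpow) simp
    finally show ?thesis .
  qed
  have A_compl: "measure gauss_measure (unit_I - A (Suc k)) = 1 - p k" for k
    using gauss.prob_compl [OF A_sets, of k] by (simp add: A_prob)
  have V_eq: "V n = (\<Sum>k<n. q k)" for n
    unfolding V_def by (simp add: sum.atLeast1_atMost_eq A_prob A_compl q_def)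
  have S_eq: "S n x = T n x + (\<Sum>k<n. p k)" if "x \<in> unit_I" for n x
    unfolding S_def using that
    by (simp add: sum.atLeast1_atMost_eq ind orbit_sum_def f_def sum_subtractf)
  have ET: "(\<integral>x. T n x \<partial>gauss_measure) = 0" for n
    unfolding orbit_sum_def
    by (subst Bochner_Integration.integral_sum)
      (simp_all add: integrable_bdd_meas bdd_meas_gauss_map_funpow bdd_f integral_gauss_map_funpow integral_f)
  have ES: "(\<integral>x. S n x \<partial>gauss_measure) = (\<Sum>k<n. p k)" for n
  proof -
    have "(\<integral>x. S n x \<partial>gauss_measure) = (\<integral>x. T n x + (\<Sum>k<n. p k) \<partial>gauss_measure)"
      by (intro Bochner_Integration.integral_cong) (auto simp: S_eq)
    then show ?thesis
      by (simp add: integrable_bdd_meas bdd_T ET gauss.prob_space [simplified])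
  qed
  have VS: "gauss.variance (S n) = var n" for n
    unfolding var_def ES by (intro Bochner_Integration.integral_cong) (auto simp: S_eq)
  have "filterlim (\<lambda>n. \<Sum>k<n. q k) at_top sequentially"
    using assms(4) by (simp add: V_eq [abs_def])
  note weak = weak_conv_normalized_sum [OF this]
  have rv: "gauss.random_variable borel (normalized_sum n)" for n
    by (intro measurable_gauss_measureI bdd_measD bdd_normalized_sum)
  have "(\<lambda>n. measure (distr gauss_measure borel (normalized_sum n)) {..<z})
      \<longlonglongrightarrow> measure std_normal_distribution {..<z}"
  proof (rule weak_conv_imp_continuity_set_conv)
    show "real_distribution (distr gauss_measure borel (normalized_sum n))" for n
      by (rule gauss.real_distribution_distr [OF rv])
    show "real_distribution std_normal_distribution" by (rule real_dist_normal_dist)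
    show "weak_conv_m (\<lambda>n. distr gauss_measure borel (normalized_sum n)) std_normal_distribution"
      by (rule weak)
    have "AE x in lborel. x \<in> {z} \<longrightarrow> ennreal (std_normal_density x) = 0"
      using AE_lborel_singleton [of z] by eventually_elim simp
    then have "{z} \<in> null_sets std_normal_distribution"
      by (subst null_sets_density_iff) simp_all
    then show "emeasure std_normal_distribution (frontier {..<z}) = 0" by (simp add: null_sets_def)
  qed simp
  moreover have "measure (distr gauss_measure borel (normalized_sum n)) {..<z}
      = measure gauss_measure {\<omega> \<in> unit_I. (S n \<omega> - gauss.expectation (S n)) / sqrt (gauss.variance (S n)) < z}" for n
    unfolding VS unfolding ES
    by (subst measure_distr [OF rv])
      (auto simp: S_eq normalized_sum_def intro!: arg_cong [where f = "measure gauss_measure"])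
  ultimately show ?thesis by (simp add: measure_std_normal_lessThan)
qed

end
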